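(* For every integer $n\geq 2$, the number of parallel permutations of length $n$ (i.e. permutations $\pi$ of $[n]=\{1,\dots,n\}$ whose consecutive-minima polygon $P_\pi$ has exactly two faces) is $$\frac{2}{n-1}\binom{2n-4}{n-2}-2.$$
   Context: A permutation $\pi=\pi_1\pi_2\cdots\pi_n$ of $[n]$ is identified with the set of grid points $L_\pi=\{(i,\pi_i): 1\le i\le n\}$ in an $n\times n$ grid. A point $(i,j)\in L_\pi$ is a left-right minimum if there is no $(i',j')\in L_\pi$ with $i'<i$ and $j'<j$; it is a right-left minimum if there is no $(i',j')\in L_\pi$ with $i'>i$ and $j'<j$; it is a source if $i=1$, or $i=n$, or it is neither a left-right minimum nor a right-left minimum. Two points $(i,j),(i',j')$ of one of these three sets are consecutive (in that set) if no point $(a,b)$ of the same set satisfies $i<a<i'$ or $i'<a<i$. The consecutive-minima polygon $P_\pi$ has vertex set $L_\pi$, and two vertices $(i,j),(i',j')$ with $i<i'$ are joined by an edge if they are consecutive left-right minima, or consecutive right-left minima, or consecutive sources. An edge $((i,j),(i',j'))$ with $i<i'$ is increasing if $j<j'$ and decreasing if $j>j'$. A path is a sequence of edges $(a_0,a_1),(a_1,a_2),\dots,(a_{s-1},a_s)$ of $P_\pi$. A face of $P_\pi$ is either a maximal path of increasing edges or a maximal path of decreasing edges; the number of faces of $P_\pi$ is the number of such maximal paths.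
   Formalization: Faces are counted as polygonal lines in the plane, so maximal paths drawing the same line are one face; counting paths as edge sequences makes 12…n and n…21 parallel for n ≥ 3 (e.g. 123), and the stated formula would then be too small by 2. *)

theory Defs
  imports
    "HOL-Analysis.Analysis"
    "HOL-Combinatorics.Permutations"
    "HOL-Library.Sublist"
begin

type_synonym point = "nat \<times> nat"
type_synonym edge = "point \<times> point"

definition perm_points :: "nat \<Rightarrow> (nat \<Rightarrow> nat) \<Rightarrow> point set" where
  "perm_points n \<pi> = {(i, \<pi> i) | i. 1 \<le> i \<and> i \<le> n}"

definition lr_minima :: "nat \<Rightarrow> (nat \<Rightarrow> nat) \<Rightarrow> point set" where
  "lr_minima n \<pi> = {(i, j) \<in> perm_points n \<pi>.
     \<not> (\<exists>(i', j') \<in> perm_points n \<pi>. i' < i \<and> j' < j)}"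

definition rl_minima :: "nat \<Rightarrow> (nat \<Rightarrow> nat) \<Rightarrow> point set" where
  "rl_minima n \<pi> = {(i, j) \<in> perm_points n \<pi>.
     \<not> (\<exists>(i', j') \<in> perm_points n \<pi>. i' > i \<and> j' < j)}"

definition sources :: "nat \<Rightarrow> (nat \<Rightarrow> nat) \<Rightarrow> point set" where
  "sources n \<pi> = {(i, j) \<in> perm_points n \<pi>.
     i = 1 \<or> i = n \<or> ((i, j) \<notin> lr_minima n \<pi> \<and> (i, j) \<notin> rl_minima n \<pi>)}"

definition consecutive_in :: "point set \<Rightarrow> point \<Rightarrow> point \<Rightarrow> bool" where
  "consecutive_in S p q \<longleftrightarrow> p \<in> S \<and> q \<in> S \<and>
     \<not> (\<exists>(a, b) \<in> S. (fst p < a \<and> a < fst q) \<or> (fst q < a \<and> a < fst p))"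

text \<open>Edges are recorded as pairs directed from left to right. They form a set: a pair that is
  consecutive in two of the three point sets contributes a single edge.\<close>

definition polygon_edges :: "nat \<Rightarrow> (nat \<Rightarrow> nat) \<Rightarrow> edge set" where
  "polygon_edges n \<pi> = {(p, q). fst p < fst q \<and>
     (consecutive_in (lr_minima n \<pi>) p q \<or>
      consecutive_in (rl_minima n \<pi>) p q \<or>
      consecutive_in (sources n \<pi>) p q)}"

definition increasing_edges :: "nat \<Rightarrow> (nat \<Rightarrow> nat) \<Rightarrow> edge set" where
  "increasing_edges n \<pi> = {(p, q) \<in> polygon_edges n \<pi>. snd p < snd q}"

definition decreasing_edges :: "nat \<Rightarrow> (nat \<Rightarrow> nat) \<Rightarrow> edge set" where
  "decreasing_edges n \<pi> = {(p, q) \<in> polygon_edges n \<pi>. snd p > snd q}"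

definition is_path :: "edge set \<Rightarrow> edge list \<Rightarrow> bool" where
  "is_path E es \<longleftrightarrow> es \<noteq> [] \<and> set es \<subseteq> E \<and>
     (\<forall>k. Suc k < length es \<longrightarrow> snd (es ! k) = fst (es ! Suc k))"

definition maximal_path :: "edge set \<Rightarrow> edge list \<Rightarrow> bool" where
  "maximal_path E es \<longleftrightarrow> is_path E es \<and>
     (\<forall>es'. is_path E es' \<and> sublist es es' \<longrightarrow> es' = es)"

definition plane_point :: "point \<Rightarrow> real \<times> real" where
  "plane_point p = (real (fst p), real (snd p))"

definition path_line :: "edge list \<Rightarrow> (real \<times> real) set" where
  "path_line es = (\<Union>(p, q) \<in> set es. closed_segment (plane_point p) (plane_point q))"

text \<open>A face is a side of the polygon, that is, the polygonal line in the plane drawn by a maximal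
  monotone path; paths drawing the same line give the same face. This matters only for the
  degenerate polygons of \<open>1 2 \<dots> n\<close> and \<open>n \<dots> 2 1\<close> with \<open>n \<ge> 3\<close>. There the edge joining
  the first and last points, which are the only two sources, runs along the line through all the
  points, and the two maximal edge sequences draw one segment.\<close>

definition faces :: "nat \<Rightarrow> (nat \<Rightarrow> nat) \<Rightarrow> (real \<times> real) set set" where
  "faces n \<pi> =
     path_line ` {es. maximal_path (increasing_edges n \<pi>) es} \<union>
     path_line ` {es. maximal_path (decreasing_edges n \<pi>) es}"

definition parallel_permutations :: "nat \<Rightarrow> (nat \<Rightarrow> nat) set" where
  "parallel_permutations n = {\<pi>. \<pi> permutes {1..n} \<and> card (faces n \<pi>) = 2}"

end

theory Submission
  imports Defs
begin

text \<open>If the value \<open>1\<close> stands at an interior position, the left-right minima, the right-left minima and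
  the sources contribute three different faces. If \<open>\<pi> 1 = 1\<close>, the polygon consists of the
  increasing line through the right-left minima and the line through the sources, with common end
  points; there are two faces iff the sources increase and \<open>\<pi>\<close> is not the identity, and the sources
  increase iff \<open>\<pi> n = n\<close> and \<open>\<pi>\<close> avoids the pattern 321. The case \<open>\<pi> n = 1\<close> is the mirror image. So
  the number sought is twice the number of 321-avoiding permutations of \<open>n - 2\<close> letters other than
  the identity. The 321-avoiding permutations of length \<open>n\<close> whose last \<open>t\<close> entries increase satisfy
  the ballot recursion \<open>A(n + 1, t) = A(n + 1, t + 1) + A(n, t - 1)\<close>, and \<open>A(n, 0)\<close> is a Catalan number.\<close>

section \<open>321-avoiding permutations\<close>

text \<open>A face is a set of points of the plane, so different maximal paths may draw the same
  face and counting paths does not suffice. Faces are told apart in two ways: by direction, since no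
  increasing path draws the line of a decreasing one, or by a vertex that lies on one line and
  misses the other. That paths cannot switch lines rests on one fact: a source at an interior
  abscissa is by definition no minimum, so the source chain meets the other chains only at the
  abscissas \<open>1\<close> and \<open>n\<close>.

  In the enumeration the parameter \<open>t\<close> is forced. Erasing the maximum keeps a
  permutation 321-avoiding, but the maximum can be put back only in front of an increasing suffix,
  so the length of that suffix has to be recorded. The recursion then runs downwards in
  \<open>t\<close>, from the increasing list at \<open>t = n\<close>. The length
  \<open>n - 2\<close> arises because \<open>\<pi> 1 = 1\<close> and \<open>\<pi> n = n\<close> are
  both fixed, and extremal values at the ends take part in no pattern 321.\<close>

fun avoids_321 :: "nat list \<Rightarrow> bool" where
  "avoids_321 [] \<longleftrightarrow> True"
| "avoids_321 (x # xs) \<longleftrightarrow> sorted (filter (\<lambda>y. y < x) xs) \<and> avoids_321 xs"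

text \<open>In a pattern 321 the maximum can only be the letter 3, so inserting it creates a new
  pattern exactly when a descent follows it. The filters belonging to entries of \<open>ys\<close>
  discard \<open>m\<close>, which exceeds all of them.\<close>

lemma avoids_321_insert_max:
  assumes "\<forall>x\<in>set (ys @ zs). x < m"
  shows "avoids_321 (ys @ m # zs) \<longleftrightarrow> avoids_321 (ys @ zs) \<and> sorted zs"
  using assms
proof (induction ys)
  case Nil
  then have "filter (\<lambda>y. y < m) zs = zs" by (simp add: filter_id_conv)
  then show ?case by auto
qed auto

lemma avoids_321_upt: "avoids_321 [a..<b]"
proof (induction "b - a" arbitrary: a)
  case (Suc k)
  then show ?case by (simp add: upt_rec[of a b] sorted_wrt_filter)
qed simp

lemma sorted_filter_iff: "sorted (filter P xs) \<longleftrightarrow> sorted_wrt (\<lambda>x y. P x \<longrightarrow> P y \<longrightarrow> x \<le> y) xs"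
  by (induction xs) auto

lemma sorted_wrt_upt_iff:
  "sorted_wrt R [a..<b] \<longleftrightarrow> (\<forall>j k. a \<le> j \<and> j < k \<and> k < b \<longrightarrow> R j k)" for a b :: nat
proof
  assume R: "sorted_wrt R [a..<b]"
  show "\<forall>j k. a \<le> j \<and> j < k \<and> k < b \<longrightarrow> R j k"
  proof (intro allI impI; elim conjE)
    fix j k assume "a \<le> j" "j < k" "k < b"
    then show "R j k"
      using sorted_wrt_nth_less[OF R, of "j - a" "k - a"] by simp
  qed
qed (auto simp: sorted_wrt_iff_nth_less)

lemma avoids_321_map_upt:
  "avoids_321 (map f [a..<b]) \<longleftrightarrow>
     (\<forall>i j k. a \<le> i \<and> i < j \<and> j < k \<and> k < b \<longrightarrow> \<not> (f j < f i \<and> f k < f j))"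
proof (induction "b - a" arbitrary: a)
  case (Suc m)
  then have "a < b" by simp
  have IH: "avoids_321 (map f [Suc a..<b]) \<longleftrightarrow>
     (\<forall>i j k. Suc a \<le> i \<and> i < j \<and> j < k \<and> k < b \<longrightarrow> \<not> (f j < f i \<and> f k < f j))"
    using Suc by simp
  have head: "sorted (filter (\<lambda>y. y < f a) (map f [Suc a..<b])) \<longleftrightarrow>
      (\<forall>j k. a < j \<and> j < k \<and> k < b \<longrightarrow> \<not> (f j < f a \<and> f k < f j))"
    unfolding sorted_filter_iff sorted_wrt_map sorted_wrt_upt_iff Suc_le_eq
    by (meson less_trans not_le)
  have "avoids_321 (map f [a..<b]) \<longleftrightarrow>
      sorted (filter (\<lambda>y. y < f a) (map f [Suc a..<b])) \<and> avoids_321 (map f [Suc a..<b])"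
    using \<open>a < b\<close> by (simp add: upt_conv_Cons)
  also have "\<dots> \<longleftrightarrow> (\<forall>i j k. a \<le> i \<and> i < j \<and> j < k \<and> k < b \<longrightarrow> \<not> (f j < f i \<and> f k < f j))"
    unfolding IH head le_less[of a] Suc_le_eq by blast
  finally show ?case .
qed auto

text \<open>The offset \<open>a\<close> is there because the letters finally counted form
  \<open>{2..<n}\<close>. The suffix condition is of the kind "at least": the sets shrink as
  \<open>t\<close> grows, and the difference of two successive ones fixes the exact length of the
  longest increasing suffix.\<close>

definition avoiders :: "nat \<Rightarrow> nat \<Rightarrow> nat \<Rightarrow> nat list set" where
  "avoiders a n t = {xs. distinct xs \<and> set xs = {a..<a + n} \<and> avoids_321 xs \<and> sorted (drop (n - t) xs)}"

lemma length_avoiders: "xs \<in> avoiders a n t \<Longrightarrow> length xs = n"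
  by (auto simp: avoiders_def dest: distinct_card)

lemma finite_avoiders [simp]: "finite (avoiders a n t)"
proof (rule finite_subset)
  show "avoiders a n t \<subseteq> {xs. set xs \<subseteq> {a..<a + n} \<and> length xs = n}"
    using length_avoiders by (auto simp: avoiders_def)
qed (simp add: finite_lists_length_eq)

lemma avoiders_sorted: "avoiders a n n = {[a..<a + n]}"
proof -
  have "xs = [a..<a + n]" if "distinct xs" "set xs = {a..<a + n}" "sorted xs" for xs
    using that by (intro sorted_distinct_set_unique) auto
  then show ?thesis by (auto simp: avoiders_def avoids_321_upt)
qed

text \<open>A suffix of one entry is always sorted. This supplies the value at \<open>t = 0\<close>,
  which the recursion does not reach because its left-hand side has a positive parameter.\<close>

lemma avoiders_0: "avoiders a (Suc n) 0 = avoiders a (Suc n) 1"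
proof -
  have "sorted (drop n xs)" if "length xs = Suc n" for xs :: "nat list"
    using that by (cases "drop n xs"; cases "tl (drop n xs)")
      (auto dest: arg_cong[of _ _ length])
  moreover have "length xs = Suc n" if "distinct xs" "set xs = {a..<a + Suc n}" for xs :: "nat list"
    using that distinct_card by fastforce
  ultimately show ?thesis by (auto simp: avoiders_def)
qed

text \<open>Erasing the maximum is inverse to this insertion: if it is not the last entry, it stands
  right before the maximal increasing suffix, since only an increasing sequence may follow it.\<close>

definition insert_max :: "nat \<Rightarrow> nat \<Rightarrow> nat list \<Rightarrow> nat list" where
  "insert_max m k xs = (if sorted (drop k xs) then take k xs @ m # drop k xs else xs @ [m])"

text \<open>Both branches of the insertion make the longest increasing suffix have length exactly
  \<open>t + 1\<close>. If the last \<open>t + 1\<close> old entries increase, the maximum in front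
  of them stops the suffix; otherwise appending the maximum lengthens the suffix of length
  \<open>t\<close> by one.\<close>

lemma bij_betw_insert_max:
  assumes "t < n"
  shows "bij_betw (insert_max (a + n) (n - Suc t)) (avoiders a n t)
           (avoiders a (Suc n) (Suc t) - avoiders a (Suc n) (Suc (Suc t)))"
proof -
  define k where "k = n - Suc t"
  have k: "n - Suc t = k" "Suc n - Suc t = Suc k" "Suc n - Suc (Suc t) = k" "n - t = Suc k" "k < n"
    using assms by (auto simp: k_def)
  show ?thesis
    unfolding k(1)
  proof (rule bij_betwI[where g = "remove1 (a + n)"])
    show "insert_max (a + n) k \<in> avoiders a n t \<rightarrow>
        avoiders a (Suc n) (Suc t) - avoiders a (Suc n) (Suc (Suc t))"
    proof
      fix xs assume xs: "xs \<in> avoiders a n t"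
      then have len: "length xs = n" by (rule length_avoiders)
      have X: "distinct xs" "set xs = {a..<a + n}" "avoids_321 xs" "sorted (drop (Suc k) xs)"
        using xs k by (auto simp: avoiders_def)
      show "insert_max (a + n) k xs \<in> avoiders a (Suc n) (Suc t) - avoiders a (Suc n) (Suc (Suc t))"
      proof (cases "sorted (drop k xs)")
        case True
        define y where "y = take k xs"
        define z where "z = drop k xs"
        have yz: "xs = y @ z" and ly: "length y = k" and lz: "z \<noteq> []" and sz: "sorted z"
          using len k True by (auto simp: y_def z_def)
        have mx: "\<forall>x\<in>set (y @ z). x < a + n" using X(2) yz by auto
        have av: "avoids_321 (y @ (a + n) # z)"
          using avoids_321_insert_max[OF mx] X sz yz by simp
        have di: "distinct (y @ (a + n) # z)" using X(1) yz mx by auto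
        have "set (y @ (a + n) # z) = insert (a + n) (set xs)" using yz by auto
        then have st: "set (y @ (a + n) # z) = {a..<a + Suc n}" using X(2) by auto
        \<comment> \<open>This is where \<open>k < n\<close> matters: \<open>z\<close> is nonempty,
          so the maximum in front of it starts a descent.\<close>
        have ns: "\<not> sorted ((a + n) # z)"
          using mx lz by (cases z) auto
        have eq: "insert_max (a + n) k xs = y @ (a + n) # z"
          using True by (simp add: insert_max_def y_def z_def)
        have d1: "drop k (y @ (a + n) # z) = (a + n) # z" using ly by simp
        have d2: "drop (Suc k) (y @ (a + n) # z) = z" using ly by simp
        show ?thesis
          unfolding avoiders_def k mem_Collect_eq Diff_iff eq d1 d2
          using av di st ns sz by simp
      next
        case False
        have mx: "\<forall>x\<in>set (xs @ []). x < a + n" using X by auto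
        have av: "avoids_321 (xs @ [a + n])"
          using avoids_321_insert_max[OF mx] X by simp
        have d1: "drop k (xs @ [a + n]) = drop k xs @ [a + n]"
          and d2: "drop (Suc k) (xs @ [a + n]) = drop (Suc k) xs @ [a + n]"
          using len k by auto
        have s: "sorted (drop (Suc k) xs @ [a + n])"
          using X(4) mx by (auto simp: sorted_append less_imp_le dest!: in_set_dropD)
        show ?thesis
          unfolding avoiders_def insert_max_def k if_not_P[OF False] mem_Collect_eq Diff_iff d1 d2
          using av X False s by (auto simp: sorted_append)
      qed
    qed
    have main: "remove1 (a + n) zs \<in> avoiders a n t \<and> insert_max (a + n) k (remove1 (a + n) zs) = zs"
      if "zs \<in> avoiders a (Suc n) (Suc t) - avoiders a (Suc n) (Suc (Suc t))" for zs
    proof -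
      have Z: "distinct zs" "set zs = {a..<a + Suc n}" "avoids_321 zs"
        "sorted (drop (Suc k) zs)" "\<not> sorted (drop k zs)"
        using that k by (auto simp: avoiders_def)
      have len: "length zs = Suc n" using that by (auto dest: length_avoiders)
      have "a + n \<in> set zs" using Z by simp
      then obtain ys us where zs: "zs = ys @ (a + n) # us" by (meson split_list)
      have notin: "a + n \<notin> set ys" "a + n \<notin> set us" using Z zs by auto
      have rem: "remove1 (a + n) zs = ys @ us" using zs notin by (simp add: remove1_append)
      have "set (ys @ us) = set zs - {a + n}" using zs Z(1) by auto
      also have "\<dots> = {a..<a + n}" unfolding Z(2) by auto
      finally have st: "set (ys @ us) = {a..<a + n}" .
      then have mx: "\<forall>x\<in>set (ys @ us). x < a + n" by auto
      have av: "avoids_321 (ys @ us)" "sorted us"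
        using avoids_321_insert_max[OF mx] Z(3) zs by auto
      have di: "distinct (ys @ us)" using Z zs by auto
      show ?thesis
      proof (cases "us = []")
        case True
        then have ly: "length ys = n" using len zs by simp
        have d1: "drop k zs = drop k ys @ [a + n]"
          and d2: "drop (Suc k) zs = drop (Suc k) ys @ [a + n]"
          using ly k zs True by auto
        have "\<not> sorted (drop k ys)"
          using Z(5) mx unfolding d1 by (auto simp: sorted_append less_imp_le dest!: in_set_dropD)
        moreover have "sorted (drop (Suc k) ys)"
          using Z(4) unfolding d2 by (auto simp: sorted_append)
        ultimately show ?thesis
          unfolding rem using True zs di av st k by (auto simp: avoiders_def insert_max_def)
      next
        case False
        have ns: "\<not> sorted ((a + n) # us)" using mx False by (cases us) auto
        \<comment> \<open>The maximum must stand at index \<open>k\<close>. Further right it would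
          start a descent inside the sorted suffix; further left, the suffix from \<open>k\<close>
          on would be part of the sorted list \<open>us\<close>.\<close>
        have "\<not> Suc k \<le> length ys"
        proof
          assume "Suc k \<le> length ys"
          then have "drop (Suc k) zs = drop (Suc k) ys @ (a + n) # us" using zs by simp
          then show False using Z(4) ns sorted_wrt_append by metis
        qed
        moreover have "\<not> k > length ys"
        proof
          assume *: "k > length ys"
          have "drop k zs = drop (k - Suc (length ys)) us"
            using * zs by (simp add: drop_Cons')
          then show False using Z(5) sorted_wrt_drop[OF av(2), of "k - Suc (length ys)"] by simp
        qed
        ultimately have ly: "length ys = k" by simp
        then have "drop k (ys @ us) = us" "take k (ys @ us) = ys" "drop (Suc k) (ys @ us) = drop 1 us"
          by auto
        then show ?thesis
          unfolding rem using zs di av st k sorted_wrt_drop by (auto simp: avoiders_def insert_max_def)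
      qed
    qed
    then show "remove1 (a + n) \<in> avoiders a (Suc n) (Suc t) - avoiders a (Suc n) (Suc (Suc t)) \<rightarrow>
        avoiders a n t"
      by blast
    show "insert_max (a + n) k (remove1 (a + n) zs) = zs"
      if "zs \<in> avoiders a (Suc n) (Suc t) - avoiders a (Suc n) (Suc (Suc t))" for zs
      using main[OF that] by blast
    show "remove1 (a + n) (insert_max (a + n) k xs) = xs" if "xs \<in> avoiders a n t" for xs
    proof -
      have "a + n \<notin> set xs" using that by (auto simp: avoiders_def)
      then have "a + n \<notin> set (take k xs)" by (auto dest: in_set_takeD)
      with \<open>a + n \<notin> set xs\<close> show ?thesis
        unfolding insert_max_def by (simp add: remove1_append)
    qed
  qed
qed

lemma card_avoiders_rec:
  assumes "t < n"
  shows "card (avoiders a (Suc n) (Suc t)) = card (avoiders a (Suc n) (Suc (Suc t))) + card (avoiders a n t)"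
proof -
  have "avoiders a (Suc n) (Suc (Suc t)) \<subseteq> avoiders a (Suc n) (Suc t)"
  proof
    fix xs assume *: "xs \<in> avoiders a (Suc n) (Suc (Suc t))"
    have "drop (n - t) xs = drop 1 (drop (n - Suc t) xs)" using assms by (simp add: Suc_diff_Suc)
    then have "sorted (drop (n - t) xs)" if "sorted (drop (n - Suc t) xs)"
      using that sorted_wrt_drop by metis
    with * show "xs \<in> avoiders a (Suc n) (Suc t)"
      by (auto simp: avoiders_def)
  qed
  then show ?thesis
    using bij_betw_same_card[OF bij_betw_insert_max[OF assms, of a]]
    by (simp add: card_Diff_subset card_mono)
qed

text \<open>These are ballot numbers in the form given by the reflection principle. Both terms have
  the same upper index, so Pascal's rule applied to each of them is precisely the recursion.\<close>

lemma card_avoiders: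
  "t \<le> n \<Longrightarrow> int (card (avoiders a n t)) = int ((2 * n - t) choose n) - int ((2 * n - t) choose Suc n)"
proof (induction n arbitrary: t)
  case 0
  then show ?case using avoiders_sorted[of a 0] by simp
next
  case (Suc n)
  \<comment> \<open>The recursion expresses the value at \<open>t\<close> by the value at
    \<open>t + 1\<close>, hence an inner induction downwards from \<open>t = Suc n\<close>, where
    the increasing list is the only member.\<close>
  have pos: "int (card (avoiders a (Suc n) t)) =
      int ((2 * Suc n - t) choose Suc n) - int ((2 * Suc n - t) choose Suc (Suc n))"
    if "0 < t" "t \<le> Suc n" for t
    using that(2) that(1)
  proof (induction t rule: inc_induct)
    case base
    then show ?case using avoiders_sorted[of a "Suc n"] by simp
  next
    case (step t)
    then obtain s where t: "t = Suc s" by (cases t) auto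
    then have s: "s < n" using step by simp
    have eq: "2 * Suc n - t = Suc (2 * n - s)" "2 * Suc n - Suc t = 2 * n - s"
      using s t by auto
    show ?case
      using card_avoiders_rec[OF s, of a] step Suc.IH[of s] s unfolding eq by (simp add: t)
  qed
  show ?case
  proof (cases t)
    case 0
    \<comment> \<open>By Pascal's rule the formulas for \<open>t = 0\<close> and
      \<open>t = 1\<close> differ by these two central binomial coefficients, which are
      equal.\<close>
    have "(2 * n + 1) choose (n + 1) = (2 * n + 1) choose n"
      by (rule binomial_symmetric[THEN trans]) auto
    then show ?thesis using pos[of 1] 0 by (simp add: avoiders_0)
  qed (use pos Suc in auto)
qed

lemma catalan_formula:
  "real ((2 * k) choose k) - real ((2 * k) choose Suc k) = real ((2 * k) choose k) / (real k + 1)"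
proof -
  have "Suc k * ((2 * k) choose Suc k) = k * ((2 * k) choose k)"
    using binomial_absorb_comp[of "2 * k" k] binomial_absorption[of k "2 * k"]
    by (cases k) (auto simp: Suc_times_binomial_eq algebra_simps)
  then have "(real k + 1) * real ((2 * k) choose Suc k) = real k * real ((2 * k) choose k)"
    by (metis of_nat_Suc of_nat_mult add.commute)
  then show ?thesis by (simp add: field_simps)
qed

text \<open>The bijection is one-line notation: a permutation is the identity off the interval and
  so is determined by its list of values on it. With \<open>t = 0\<close> the suffix condition is
  vacuous.\<close>

lemma card_permutes_avoiding_321:
  "real (card {f. f permutes {a..<a + n} \<and>
      (\<forall>i j k. a \<le> i \<and> i < j \<and> j < k \<and> k < a + n \<longrightarrow> \<not> (f j < f i \<and> f k < f j))})
   = real ((2 * n) choose n) / (real n + 1)" (is "real (card ?F) = _")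
proof -
  let ?l = "\<lambda>f::nat \<Rightarrow> nat. map f [a..<a + n]"
  let ?g = "\<lambda>xs i. if i \<in> {a..<a + n} then xs ! (i - a) else i"
  have "bij_betw ?l ?F (avoiders a n 0)"
  proof (rule bij_betwI[where g = ?g])
    show "?l \<in> ?F \<rightarrow> avoiders a n 0"
      by (auto simp: avoiders_def avoids_321_map_upt distinct_map permutes_image permutes_inj_on)
    show L: "?l (?g xs) = xs" if "xs \<in> avoiders a n 0" for xs
      using length_avoiders[OF that] by (intro nth_equalityI) auto
    show "?g \<in> avoiders a n 0 \<rightarrow> ?F"
    proof
      fix xs assume xs: "xs \<in> avoiders a n 0"
      then have X: "distinct xs" "set xs = {a..<a + n}" "avoids_321 xs" by (auto simp: avoiders_def)
      note len = length_avoiders[OF xs]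
      have "inj_on (?g xs) {a..<a + n}"
        using X(1) len by (auto simp: inj_on_def nth_eq_iff_index_eq)
      moreover have "?g xs ` {a..<a + n} = set (?l (?g xs))" by auto
      then have "?g xs ` {a..<a + n} = {a..<a + n}" unfolding L[OF xs] X(2) .
      ultimately have "bij_betw (?g xs) {a..<a + n} {a..<a + n}"
        by (rule bij_betw_imageI)
      then have "?g xs permutes {a..<a + n}" by (rule bij_imp_permutes) auto
      moreover have "avoids_321 (?l (?g xs))" unfolding L[OF xs] by fact
      ultimately show "?g xs \<in> ?F" unfolding avoids_321_map_upt by blast
    qed
    show "?g (?l f) = f" if "f \<in> ?F" for f
      using that by (auto simp: fun_eq_iff permutes_not_in)
  qed
  then have "real (card ?F) = real_of_int (int (card (avoiders a n 0)))"
    by (simp add: bij_betw_same_card)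
  also have "\<dots> = real ((2 * n) choose n) - real ((2 * n) choose Suc n)"
    by (subst card_avoiders) auto
  finally show ?thesis by (simp add: catalan_formula)
qed

section \<open>Monotone paths\<close>

lemma is_path_iff:
  "is_path E es \<longleftrightarrow> es \<noteq> [] \<and> set es \<subseteq> E \<and> successively (\<lambda>e f. snd e = fst f) es"
  by (simp add: is_path_def successively_conv_nth)

lemma is_path_Cons:
  "is_path E (e # es) \<longleftrightarrow> e \<in> E \<and> (es = [] \<or> snd e = fst (hd es) \<and> is_path E es)"
  by (auto simp: is_path_iff successively_Cons)

lemma is_path_snoc:
  "is_path E (es @ [e]) \<longleftrightarrow> e \<in> E \<and> (es = [] \<or> snd (last es) = fst e \<and> is_path E es)"
  by (auto simp: is_path_iff successively_append_iff)

text \<open>For confining a path to one chain of the polygon: if \<open>F\<close> is closed under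
  continuation by edges of \<open>E\<close>, the first edge decides for the whole path.\<close>

lemma is_path_stays_in:
  assumes "is_path E es" "hd es \<in> F" "\<And>p q r. (p, q) \<in> F \<Longrightarrow> (q, r) \<in> E \<Longrightarrow> (q, r) \<in> F"
  shows "set es \<subseteq> F"
  using assms(1,2)
proof (induction es)
  case (Cons e es)
  show ?case
  proof (cases "es = []")
    case False
    then have "(fst e, fst (hd es)) \<in> F" "(fst (hd es), snd (hd es)) \<in> E"
      using Cons.prems hd_in_set[OF False] unfolding is_path_Cons
      by (auto simp: is_path_iff) (metis prod.collapse)
    then have "hd es \<in> F" using assms(3) by (metis prod.collapse)
    then show ?thesis using Cons False by (simp add: is_path_Cons)
  qed (use Cons in simp)
qed simp

text \<open>A discrete intermediate value theorem. The codomain of \<open>h\<close> is left general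
  because it serves both for abscissas of vertices and for arbitrary real abscissas.\<close>

lemma is_path_crosses:
  fixes h :: "point \<Rightarrow> 'a::linorder"
  assumes "is_path E es" "h (fst (hd es)) \<le> x" "x < h (snd (last es))"
  shows "\<exists>(p, q)\<in>set es. h p \<le> x \<and> x < h q"
  using assms
proof (induction es)
  case (Cons e es)
  show ?case
  proof (cases "es = [] \<or> x < h (snd e)")
    case True
    then show ?thesis using Cons.prems by (cases e) auto
  next
    case False
    then have "\<exists>(p, q)\<in>set es. h p \<le> x \<and> x < h q"
      using Cons by (auto simp: is_path_Cons)
    then show ?thesis by auto
  qed
qed (simp add: is_path_iff)

lemma is_path_length_le:
  assumes "is_path E es" "\<And>p q. (p, q) \<in> E \<Longrightarrow> fst p < fst q \<and> fst q \<le> n"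
  shows "length es \<le> n"
proof -
  have "length es + fst (fst (hd es)) \<le> n"
    using assms(1)
  proof (induction es)
    case (Cons e es)
    then have "fst (fst e) < fst (snd e)" "fst (snd e) \<le> n"
      using assms(2)[of "fst e" "snd e"] by (auto simp: is_path_Cons)
    then show ?case
      using Cons by (cases "es = []") (auto simp: is_path_Cons)
  qed (simp add: is_path_iff)
  then show ?thesis by simp
qed

text \<open>Abscissas grow along a path and are bounded by \<open>n\<close>, so among the paths
  through \<open>e\<close> there is a longest one. Every path extending it also runs through
  \<open>e\<close>, hence is no longer.\<close>

lemma ex_maximal_path:
  assumes e: "e \<in> E" and E: "\<And>p q. (p, q) \<in> E \<Longrightarrow> fst p < fst q \<and> fst q \<le> n"
  obtains es where "maximal_path E es" "e \<in> set es"
proof -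
  let ?P = "\<lambda>es. is_path E es \<and> e \<in> set es"
  have "?P [e]" using e by (simp add: is_path_iff)
  moreover have "\<forall>es. ?P es \<longrightarrow> length es < Suc n" using is_path_length_le[OF _ E] by (auto simp: less_Suc_eq_le)
  ultimately obtain es where es: "?P es" "\<And>fs. ?P fs \<Longrightarrow> length fs \<le> length es"
    using ex_has_greatest_nat[of ?P "[e]" length "Suc n"] by blast
  have "maximal_path E es"
    unfolding maximal_path_def
  proof (intro conjI allI impI; (elim conjE)?)
    fix fs assume fs: "is_path E fs" "sublist es fs"
    then have "length fs \<le> length es" using es set_mono_sublist by blast
    with fs(2) show "fs = es" by (auto simp: sublist_def)
  qed (use es in auto)
  with es that show ?thesis by blast
qed

lemma maximal_path_hd:
  assumes "maximal_path E es" "e \<in> E"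
  shows "snd e \<noteq> fst (hd es)"
proof
  assume "snd e = fst (hd es)"
  then have "is_path E (e # es)"
    using assms by (auto simp: is_path_Cons maximal_path_def)
  moreover have "sublist es (e # es)" by (simp add: sublist_Cons_right)
  ultimately have "e # es = es" using assms(1) unfolding maximal_path_def by blast
  then show False by simp
qed

lemma maximal_path_last:
  assumes "maximal_path E es" "e \<in> E"
  shows "fst e \<noteq> snd (last es)"
proof
  assume "fst e = snd (last es)"
  then have "is_path E (es @ [e])"
    using assms by (auto simp: is_path_snoc maximal_path_def)
  moreover have "sublist es (es @ [e])" by simp
  ultimately have "es @ [e] = es" using assms(1) unfolding maximal_path_def by blast
  then show False by simp
qed

section \<open>Polygonal lines as point sets\<close>

lemma segment_bounds:
  assumes "z \<in> closed_segment (plane_point p) (plane_point q)"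
  shows "min (fst p) (fst q) \<le> fst z" "fst z \<le> max (fst p) (fst q)"
    "min (snd p) (snd q) \<le> snd z" "snd z \<le> max (snd p) (snd q)"
proof -
  obtain u where u: "0 \<le> u" "u \<le> 1" and z: "z = (1 - u) *\<^sub>R plane_point p + u *\<^sub>R plane_point q"
    using assms by (auto simp: closed_segment_def)
  have *: "min a b \<le> (1 - u) * a + u * b" "(1 - u) * a + u * b \<le> max a b" for a b :: real
    using convex_bound_le[of a "max a b" b "1 - u" u] convex_bound_le[of "-a" "- min a b" "-b" "1 - u" u] u
    by auto
  show "min (fst p) (fst q) \<le> fst z" "fst z \<le> max (fst p) (fst q)"
    "min (snd p) (snd q) \<le> snd z" "snd z \<le> max (snd p) (snd q)"
    using *[of "real (fst p)" "real (fst q)"] *[of "real (snd p)" "real (snd q)"]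
    unfolding z by (auto simp: plane_point_def of_nat_min of_nat_max)
qed

lemma path_line_Cons:
  "path_line (e # es) = closed_segment (plane_point (fst e)) (plane_point (snd e)) \<union> path_line es"
  by (auto simp: path_line_def split: prod.split)

text \<open>The sign \<open>s\<close> is \<open>1\<close> for increasing and \<open>- 1\<close> for decreasing edges.\<close>

lemma path_line_monotone:
  fixes s :: real
  assumes "is_path E es"
    and E: "\<And>p q. (p, q) \<in> E \<Longrightarrow> fst p < fst q \<and> s * real (snd p) \<le> s * real (snd q)"
    and "z \<in> path_line es" "w \<in> path_line es"
  shows "0 \<le> s * ((fst z - fst w) * (snd z - snd w))"
proof -
  have seg: "real (fst p) \<le> fst z \<and> fst z \<le> real (fst q) \<and>
      s * real (snd p) \<le> s * snd z \<and> s * snd z \<le> s * real (snd q)"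
    if pq: "(p, q) \<in> E" and z_in: "z \<in> closed_segment (plane_point p) (plane_point q)" for p q z
  proof -
    obtain u where u: "0 \<le> u" "u \<le> 1" and z: "z = (1 - u) *\<^sub>R plane_point p + u *\<^sub>R plane_point q"
      using z_in unfolding closed_segment_def by blast
    have *: "a \<le> a + u * (b - a)" "a + u * (b - a) \<le> b" if "a \<le> b" for a b :: real
      using u that mult_left_le_one_le[of "b - a" u] by auto
    show ?thesis
      using E[OF pq] *[of "real (fst p)" "real (fst q)"] *[of "s * real (snd p)" "s * real (snd q)"]
      unfolding z by (auto simp: plane_point_def algebra_simps)
  qed
  \<comment> \<open>Points of different segments are compared through a vertex: everything on the
    rest of the path lies beyond the vertex where that rest begins, in both coordinates up to the
    sign \<open>s\<close>.\<close>
  have start: "real (fst (fst (hd es))) \<le> fst z \<and> s * real (snd (fst (hd es))) \<le> s * snd z"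
    if "is_path E es" "z \<in> path_line es" for es z
    using that
  proof (induction es)
    case (Cons e es)
    show ?case
    proof (cases "z \<in> path_line es")
      case True
      then have "es \<noteq> []" by (auto simp: path_line_def)
      then have "(fst e, snd e) \<in> E" and "snd e = fst (hd es)" "is_path E es"
        using Cons.prems(1) unfolding is_path_Cons prod.collapse by auto
      then show ?thesis
        using Cons.IH True E[of "fst e" "snd e"] by (auto simp del: prod.collapse)
    next
      case False
      then show ?thesis
        using Cons.prems seg[of "fst e" "snd e" z] by (auto simp: is_path_Cons path_line_Cons)
    qed
  qed (simp add: is_path_iff)
  have ordered: "0 \<le> s * ((fst z - fst w) * (snd z - snd w))"
    if "fst z \<le> fst w" "s * snd z \<le> s * snd w" for z w :: "real \<times> real"
  proof -
    have "0 \<le> (fst w - fst z) * (s * snd w - s * snd z)" using that by simp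
    then show ?thesis by (simp add: algebra_simps)
  qed
  have swap: "s * ((fst z - fst w) * (snd z - snd w)) = s * ((fst w - fst z) * (snd w - snd z))"
    for z w :: "real \<times> real" by (simp add: algebra_simps)
  show ?thesis
    using assms(1,3,4)
  proof (induction es)
    case (Cons e es)
    let ?S = "closed_segment (plane_point (fst e)) (plane_point (snd e))"
    have e: "(fst e, snd e) \<in> E" using Cons.prems by (simp add: is_path_Cons)
    have cross: "0 \<le> s * ((fst z - fst w) * (snd z - snd w))"
      if "z \<in> ?S" "w \<in> path_line es" for z w
    proof -
      have "es \<noteq> []" using that by (auto simp: path_line_def)
      then show ?thesis
        using seg[OF e that(1)] start[OF _ that(2)] Cons.prems
        by (intro ordered) (auto simp: is_path_Cons)
    qed
    have same: "0 \<le> s * ((fst z - fst w) * (snd z - snd w))" if zw: "z \<in> ?S" "w \<in> ?S"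
    proof -
      obtain u where z: "z = (1 - u) *\<^sub>R plane_point (fst e) + u *\<^sub>R plane_point (snd e)"
        using zw by (auto simp: closed_segment_def)
      obtain v where w: "w = (1 - v) *\<^sub>R plane_point (fst e) + v *\<^sub>R plane_point (snd e)"
        using zw by (auto simp: closed_segment_def)
      define a b where "a = real (fst (snd e)) - real (fst (fst e))"
        and "b = real (snd (snd e)) - real (snd (fst e))"
      have "0 \<le> a" "0 \<le> s * b" using E[OF e] by (auto simp: a_def b_def algebra_simps)
      \<comment> \<open>Two points with parameters \<open>u\<close> and \<open>v\<close> on one
        segment differ by \<open>u - v\<close> times its direction \<open>(a, b)\<close>, so the
        product carries the square of \<open>u - v\<close>.\<close>
      moreover have "s * ((fst z - fst w) * (snd z - snd w)) = (u - v)\<^sup>2 * (a * (s * b))"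
        unfolding z w a_def b_def by (simp add: plane_point_def power2_eq_square algebra_simps)
      ultimately show ?thesis by (metis mult_nonneg_nonneg zero_le_power2)
    qed
    have "z \<in> ?S \<or> es \<noteq> [] \<and> z \<in> path_line es" "w \<in> ?S \<or> es \<noteq> [] \<and> w \<in> path_line es"
      using Cons.prems by (auto simp: path_line_Cons path_line_def)
    then show ?case
      using same cross[of z w] cross[of w z] swap[of z w] Cons by (auto simp: is_path_Cons)
  qed (simp add: is_path_iff)
qed

lemma plane_point_in_path_line:
  assumes "(p, q) \<in> set es"
  shows "plane_point p \<in> path_line es" "plane_point q \<in> path_line es"
  using assms unfolding path_line_def by (blast intro: ends_in_segment)+

text \<open>On a line drawn by a decreasing path, the coordinate differences of two points never
  have the same strict sign; the end points of any increasing edge violate this.\<close>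

lemma increasing_path_line_neq_decreasing:
  assumes "is_path (increasing_edges n \<pi>) es" "is_path (decreasing_edges n \<pi>) fs"
  shows "path_line es \<noteq> path_line fs"
proof
  assume eq: "path_line es = path_line fs"
  obtain p q where pq: "(p, q) \<in> set es" "(p, q) \<in> increasing_edges n \<pi>"
    using assms(1) by (cases es) (auto simp: is_path_Cons is_path_iff)
  have "0 \<le> - 1 * ((fst (plane_point p) - fst (plane_point q)) * (snd (plane_point p) - snd (plane_point q)))"
    using plane_point_in_path_line[OF pq(1)] unfolding eq
    by (rule path_line_monotone[OF assms(2), rotated])
      (auto simp: decreasing_edges_def polygon_edges_def)
  moreover have "real (fst p) < real (fst q)" "real (snd p) < real (snd q)"
    using pq(2) by (auto simp: increasing_edges_def polygon_edges_def)
  then have "0 < (real (fst p) - real (fst q)) * (real (snd p) - real (snd q))"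
    by (simp add: mult_neg_neg)
  ultimately show False by (simp add: plane_point_def)
qed

section \<open>Faces of the consecutive-minima polygon\<close>

text \<open>The contribution of a single point set to the polygon, isolated so that the three kinds
  of edges share one set of facts.\<close>

definition chain_edges :: "point set \<Rightarrow> edge set" where
  "chain_edges S = {(p, q). fst p < fst q \<and> consecutive_in S p q}"

lemma polygon_edges_eq:
  "polygon_edges n \<pi> =
     chain_edges (lr_minima n \<pi>) \<union> chain_edges (rl_minima n \<pi>) \<union> chain_edges (sources n \<pi>)"
  by (auto simp: polygon_edges_def chain_edges_def)

lemma chain_edgesD:
  assumes "(p, q) \<in> chain_edges S"
  shows "p \<in> S" "q \<in> S" "fst p < fst q" "r \<in> S \<Longrightarrow> fst r \<le> fst p \<or> fst q \<le> fst r"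
proof -
  show "p \<in> S" "q \<in> S" "fst p < fst q"
    using assms by (auto simp: chain_edges_def consecutive_in_def)
  assume "r \<in> S"
  moreover have "\<forall>(a, b)\<in>S. \<not> (fst p < a \<and> a < fst q)"
    using assms by (auto simp: chain_edges_def consecutive_in_def)
  ultimately show "fst r \<le> fst p \<or> fst q \<le> fst r" by (cases r) (auto simp: not_less)
qed

lemma chain_edgesI:
  assumes "p \<in> S" "q \<in> S" "fst p < fst q" "\<And>r. r \<in> S \<Longrightarrow> fst r \<le> fst p \<or> fst q \<le> fst r"
  shows "(p, q) \<in> chain_edges S"
proof -
  have "\<not> (fst p < a \<and> a < fst q)" "\<not> (fst q < a \<and> a < fst p)" if "(a, b) \<in> S" for a b
    using assms(3) assms(4)[OF that] by auto
  then show ?thesis using assms(1-3) by (auto simp: chain_edges_def consecutive_in_def)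
qed

lemma ex_chain_edge_right:
  assumes "p \<in> S" "r \<in> S" "fst p < fst r"
  obtains q where "(p, q) \<in> chain_edges S"
proof -
  obtain q where q: "q \<in> S \<and> fst p < fst q" "\<And>s. s \<in> S \<and> fst p < fst s \<Longrightarrow> fst q \<le> fst s"
    using ex_has_least_nat[of "\<lambda>q. q \<in> S \<and> fst p < fst q" r fst] assms by blast
  have "(p, q) \<in> chain_edges S"
    by (rule chain_edgesI) (use assms q in \<open>auto simp: not_less[symmetric]\<close>)
  then show ?thesis by (rule that)
qed

lemma ex_chain_edge_left:
  assumes "q \<in> S" "r \<in> S" "fst r < fst q"
  obtains p where "(p, q) \<in> chain_edges S"
proof -
  obtain p where p: "p \<in> S \<and> fst p < fst q" "\<And>s. s \<in> S \<and> fst s < fst q \<Longrightarrow> fst s \<le> fst p"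
    using ex_has_greatest_nat[of "\<lambda>p. p \<in> S \<and> fst p < fst q" r fst "fst q"] assms by blast
  have "(p, q) \<in> chain_edges S"
    by (rule chain_edgesI) (use assms p in \<open>auto simp: not_less[symmetric]\<close>)
  then show ?thesis by (rule that)
qed

section \<open>Minima, sources and edges of the polygon\<close>

lemma perm_points_iff: "p \<in> perm_points n \<pi> \<longleftrightarrow> 1 \<le> fst p \<and> fst p \<le> n \<and> snd p = \<pi> (fst p)"
  by (cases p) (auto simp: perm_points_def)

lemma minima_subset_perm_points:
  "lr_minima n \<pi> \<subseteq> perm_points n \<pi>" "rl_minima n \<pi> \<subseteq> perm_points n \<pi>"
  "sources n \<pi> \<subseteq> perm_points n \<pi>"
  by (auto simp: lr_minima_def rl_minima_def sources_def)

lemma lr_minima_iff: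
  "p \<in> lr_minima n \<pi> \<longleftrightarrow> p \<in> perm_points n \<pi> \<and> (\<forall>i. 1 \<le> i \<longrightarrow> i < fst p \<longrightarrow> snd p \<le> \<pi> i)"
proof -
  have "(\<exists>(i', j')\<in>perm_points n \<pi>. i' < fst p \<and> j' < snd p) \<longleftrightarrow>
      (\<exists>i. 1 \<le> i \<and> i < fst p \<and> \<pi> i < snd p)" if "p \<in> perm_points n \<pi>"
    using that by (auto simp: perm_points_def)
  then show ?thesis by (cases p) (auto simp: lr_minima_def not_less[symmetric])
qed

lemma rl_minima_iff:
  "p \<in> rl_minima n \<pi> \<longleftrightarrow> p \<in> perm_points n \<pi> \<and> (\<forall>i. fst p < i \<longrightarrow> i \<le> n \<longrightarrow> snd p \<le> \<pi> i)"
proof -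
  have "(\<exists>(i', j')\<in>perm_points n \<pi>. i' > fst p \<and> j' < snd p) \<longleftrightarrow>
      (\<exists>i. i \<le> n \<and> fst p < i \<and> \<pi> i < snd p)" if "p \<in> perm_points n \<pi>"
    using that by (auto simp: perm_points_def) (meson le_trans less_imp_le)
  then show ?thesis by (cases p) (auto simp: rl_minima_def not_less[symmetric])
qed

lemma sources_iff:
  "p \<in> sources n \<pi> \<longleftrightarrow> p \<in> perm_points n \<pi> \<and>
     (fst p = 1 \<or> fst p = n \<or> p \<notin> lr_minima n \<pi> \<and> p \<notin> rl_minima n \<pi>)"
  by (cases p) (simp add: sources_def)

lemma perm_points_eqI:
  "p \<in> perm_points n \<pi> \<Longrightarrow> q \<in> perm_points n \<pi> \<Longrightarrow> fst p = fst q \<Longrightarrow> p = q"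
  by (auto simp: perm_points_iff prod_eq_iff)

lemma polygon_edgesD:
  assumes "(p, q) \<in> polygon_edges n \<pi>"
  shows "p \<in> perm_points n \<pi>" "q \<in> perm_points n \<pi>" "fst p < fst q" "1 \<le> fst p" "fst q \<le> n"
proof -
  obtain X where "(p, q) \<in> chain_edges X" "X \<subseteq> perm_points n \<pi>"
    using assms minima_subset_perm_points unfolding polygon_edges_eq by blast
  then show "p \<in> perm_points n \<pi>" "q \<in> perm_points n \<pi>" "fst p < fst q"
    using chain_edgesD(1-3) by blast+
  then show "1 \<le> fst p" "fst q \<le> n" by (auto simp: perm_points_iff)
qed

lemma card_neq_2: "a \<in> S \<Longrightarrow> b \<in> S \<Longrightarrow> c \<in> S \<Longrightarrow> a \<noteq> b \<Longrightarrow> a \<noteq> c \<Longrightarrow> b \<noteq> c \<Longrightarrow> card S \<noteq> 2"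
  by (auto simp: card_2_iff)

lemma increasing_subset_polygon_edges: "increasing_edges n \<pi> \<subseteq> polygon_edges n \<pi>"
  and decreasing_subset_polygon_edges: "decreasing_edges n \<pi> \<subseteq> polygon_edges n \<pi>"
  by (auto simp: increasing_edges_def decreasing_edges_def)

lemma ex_maximal_path_polygon:
  assumes "e \<in> E" "E \<subseteq> polygon_edges n \<pi>"
  obtains es where "maximal_path E es" "e \<in> set es"
proof (rule ex_maximal_path[OF assms(1)])
  show "fst p < fst q \<and> fst q \<le> n" if "(p, q) \<in> E" for p q
    using that assms(2) polygon_edgesD(3,5)[of p q n \<pi>] by auto
qed

text \<open>Edges point to the right, so no edge of the polygon ends at abscissa \<open>1\<close>,
  and an edge that starts there cannot have a predecessor.\<close>

lemma path_hd_eq: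
  assumes "is_path E es" "E \<subseteq> polygon_edges n \<pi>" "f \<in> set es" "fst (fst f) = 1"
  shows "hd es = f"
proof -
  obtain xs ys where es: "es = xs @ f # ys" using assms(3) by (meson split_list)
  show ?thesis
  proof (cases xs rule: rev_cases)
    case (snoc zs g)
    then have "snd g = fst f" "g \<in> E"
      using assms(1) es by (auto simp: is_path_iff successively_append_iff)
    then have "(fst g, fst f) \<in> polygon_edges n \<pi>"
      using assms(2) by (metis prod.collapse subsetD)
    then have False using polygon_edgesD(3,4)[of "fst g" "fst f" n \<pi>] assms(4) by simp
    then show ?thesis ..
  qed (simp add: es)
qed

text \<open>The vertex \<open>q\<close> has an edge on either side, so its abscissa is neither
  \<open>1\<close> nor \<open>n\<close>. As a source it is then no minimum of either kind, and the
  only chain leaving it is that of the sources.\<close>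

lemma source_edge_continues:
  assumes "(p, q) \<in> chain_edges (sources n \<pi>)" "(q, r) \<in> polygon_edges n \<pi>"
  shows "(q, r) \<in> chain_edges (sources n \<pi>)"
proof -
  have "(p, q) \<in> polygon_edges n \<pi>" using assms by (simp add: polygon_edges_eq)
  then have "q \<in> sources n \<pi>" "1 < fst q" "fst q < n"
    using chain_edgesD(2)[OF assms(1)] polygon_edgesD(3,4)[of p q n \<pi>]
      polygon_edgesD(3,5)[OF assms(2)] by auto
  then have "q \<notin> lr_minima n \<pi>" "q \<notin> rl_minima n \<pi>" by (auto simp: sources_iff)
  then show ?thesis
    using assms(2) chain_edgesD(1) unfolding polygon_edges_eq by blast
qed

section \<open>The value 1 at an interior position\<close>

lemma permutes_Icc_neq:
  fixes \<pi> :: "nat \<Rightarrow> nat"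
  assumes "\<pi> permutes {1..n}" "i \<noteq> j"
  shows "\<pi> i \<noteq> \<pi> j"
  using permutes_inj[OF assms(1)] assms(2) by (auto dest: injD)

lemma permutes_Icc_bounds:
  fixes \<pi> :: "nat \<Rightarrow> nat"
  assumes "\<pi> permutes {1..n}" "1 \<le> i" "i \<le> n"
  shows "1 \<le> \<pi> i" "\<pi> i \<le> n"
  using permutes_in_image[OF assms(1), of i] assms by auto

text \<open>The point \<open>(m, 1)\<close> is a minimum of both kinds: a decreasing edge enters it
  and an increasing edge leaves it, which gives two faces of different direction through it. The
  face starting with the first source edge has only sources as vertices, all above height
  \<open>1\<close>, so it misses this point and is a third one.\<close>

lemma interior_minimum_not_parallel:
  assumes \<pi>: "\<pi> permutes {1..n}" and m: "1 < m" "m < n" "\<pi> m = 1"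
  shows "card (faces n \<pi>) \<noteq> 2"
proof -
  let ?I = "increasing_edges n \<pi>" and ?D = "decreasing_edges n \<pi>"
  have gt1: "1 < \<pi> i" if "1 \<le> i" "i \<le> n" "i \<noteq> m" for i
    using permutes_Icc_bounds[OF \<pi> that(1,2)] permutes_Icc_neq[OF \<pi> that(3)] m by auto
  have ge1: "1 \<le> \<pi> i" if "1 \<le> i" "i \<le> n" for i using permutes_Icc_bounds[OF \<pi> that] by simp
  have mlr: "(m, 1) \<in> lr_minima n \<pi>" and mrl: "(m, 1) \<in> rl_minima n \<pi>"
    using m ge1 by (auto simp: lr_minima_iff rl_minima_iff perm_points_iff)
  have ends: "(1, \<pi> 1) \<in> lr_minima n \<pi>" "(n, \<pi> n) \<in> rl_minima n \<pi>"
    "(1, \<pi> 1) \<in> sources n \<pi>" "(n, \<pi> n) \<in> sources n \<pi>"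
    using m by (auto simp: lr_minima_iff rl_minima_iff sources_iff perm_points_iff)
  obtain p where p: "(p, (m, 1)) \<in> chain_edges (lr_minima n \<pi>)"
    using ex_chain_edge_left[OF mlr ends(1)] m by auto
  obtain q where q: "((m, 1), q) \<in> chain_edges (rl_minima n \<pi>)"
    using ex_chain_edge_right[OF mrl ends(2)] m by auto
  obtain r where r: "((1, \<pi> 1), r) \<in> chain_edges (sources n \<pi>)"
    using ex_chain_edge_right[OF ends(3,4)] m by auto
  have poly: "(p, (m, 1)) \<in> polygon_edges n \<pi>" "((m, 1), q) \<in> polygon_edges n \<pi>"
    "((1, \<pi> 1), r) \<in> polygon_edges n \<pi>"
    using p q r by (auto simp: polygon_edges_eq)
  have "1 < snd p" "1 < snd q" "snd r \<noteq> \<pi> 1"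
    using polygon_edgesD[OF poly(1)] polygon_edgesD[OF poly(2)] polygon_edgesD[OF poly(3)]
      gt1[of "fst p"] gt1[of "fst q"] permutes_Icc_neq[OF \<pi>, of "fst r" 1]
    by (auto simp: perm_points_iff)
  then have "(p, (m, 1)) \<in> ?D" "((m, 1), q) \<in> ?I" and rE: "((1, \<pi> 1), r) \<in> ?I \<or> ((1, \<pi> 1), r) \<in> ?D"
    using poly by (auto simp: increasing_edges_def decreasing_edges_def)
  then obtain d i where d: "maximal_path ?D d" "(p, (m, 1)) \<in> set d"
    and i: "maximal_path ?I i" "((m, 1), q) \<in> set i"
    by (metis ex_maximal_path_polygon increasing_subset_polygon_edges decreasing_subset_polygon_edges)
  \<comment> \<open>Whether the first source edge rises or falls is not known; \<open>E\<close>
    stands for the edge set of its direction.\<close>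
  obtain E s where E: "E = ?I \<or> E = ?D" and s: "maximal_path E s" "((1, \<pi> 1), r) \<in> set s"
    using rE by (metis ex_maximal_path_polygon increasing_subset_polygon_edges decreasing_subset_polygon_edges)
  have Ep: "E \<subseteq> polygon_edges n \<pi>"
    using E increasing_subset_polygon_edges decreasing_subset_polygon_edges by blast
  have sp: "is_path E s" using s(1) by (simp add: maximal_path_def)
  have hd: "hd s = ((1, \<pi> 1), r)"
    by (rule path_hd_eq[OF sp Ep s(2)]) simp
  have S: "set s \<subseteq> chain_edges (sources n \<pi>)"
    using sp
  proof (rule is_path_stays_in)
    show "hd s \<in> chain_edges (sources n \<pi>)" using r hd by simp
  qed (use source_edge_continues Ep in blast)
  have "plane_point (m, 1) \<notin> path_line s"
  proof
    assume "plane_point (m, 1) \<in> path_line s"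
    then obtain a b where ab: "(a, b) \<in> set s" "plane_point (m, 1) \<in> closed_segment (plane_point a) (plane_point b)"
      unfolding path_line_def by blast
    have m_notin: "(m, 1) \<notin> sources n \<pi>" using m mlr by (simp add: sources_iff)
    have above: "1 < snd c" if c: "c \<in> sources n \<pi>" for c
    proof -
      have "1 \<le> fst c" "fst c \<le> n" "snd c = \<pi> (fst c)" using c by (auto simp: sources_iff perm_points_iff)
      moreover from this have "fst c \<noteq> m" using c m(3) m_notin by (metis prod.collapse)
      ultimately show ?thesis using gt1 by simp
    qed
    have "1 < snd a" "1 < snd b"
      using above chain_edgesD(1,2) S ab(1) by blast+
    then show False
      using segment_bounds(3)[OF ab(2)] by (simp add: plane_point_def)
  qed
  moreover have "plane_point (m, 1) \<in> path_line d" "plane_point (m, 1) \<in> path_line i"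
    using plane_point_in_path_line d(2) i(2) by blast+
  moreover have "path_line i \<noteq> path_line d"
    using increasing_path_line_neq_decreasing d(1) i(1) by (auto simp: maximal_path_def)
  moreover have "path_line i \<in> faces n \<pi>" "path_line d \<in> faces n \<pi>" "path_line s \<in> faces n \<pi>"
    using d(1) i(1) s(1) E by (auto simp: faces_def)
  ultimately show ?thesis by (metis card_neq_2)
qed

section \<open>Permutations that begin with 1\<close>

locale perm_from_1 =
  fixes n :: nat and \<pi> :: "nat \<Rightarrow> nat"
  assumes permutes: "\<pi> permutes {1..n}" and two_le: "2 \<le> n" and at_1: "\<pi> 1 = 1"
begin

abbreviation "P \<equiv> perm_points n \<pi>"
abbreviation "R \<equiv> rl_minima n \<pi>"
abbreviation "S \<equiv> sources n \<pi>"
abbreviation "I \<equiv> increasing_edges n \<pi>"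
abbreviation "D \<equiv> decreasing_edges n \<pi>"

lemma neq: "i \<noteq> j \<Longrightarrow> \<pi> i \<noteq> \<pi> j"
  using permutes_Icc_neq[OF permutes] .

lemma gt_1: "1 < i \<Longrightarrow> i \<le> n \<Longrightarrow> 1 < \<pi> i"
  using permutes_Icc_bounds[OF permutes, of i] neq[of i 1] at_1 by auto

text \<open>The point \<open>(1, 1)\<close> lies to the left of and below every other point. A
  single left-right minimum gives no edge, so only the chains of \<open>R\<close> and
  \<open>S\<close> remain.\<close>

lemma lr_minima_eq: "lr_minima n \<pi> = {(1, 1)}"
proof -
  have "p = (1, 1)" if "p \<in> lr_minima n \<pi>" for p
  proof (rule ccontr)
    assume "p \<noteq> (1, 1)"
    then have "1 < fst p" using that at_1 by (cases p) (force simp: lr_minima_iff perm_points_iff)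
    then show False using that gt_1[of "fst p"] at_1 by (auto simp: lr_minima_iff perm_points_iff)
  qed
  moreover have "(1, 1) \<in> lr_minima n \<pi>"
    using two_le at_1 by (auto simp: lr_minima_iff perm_points_iff)
  ultimately show ?thesis by blast
qed

lemma ends: "(1, 1) \<in> R" "(n, \<pi> n) \<in> R" "(1, 1) \<in> S" "(n, \<pi> n) \<in> S"
  using two_le at_1 permutes_Icc_bounds[OF permutes]
  by (auto simp: rl_minima_iff sources_iff perm_points_iff)

lemma in_S_iff: "p \<in> S \<longleftrightarrow> p \<in> P \<and> (fst p = 1 \<or> fst p = n \<or> p \<notin> R)"
  using at_1 by (auto simp: sources_iff lr_minima_eq)

lemma polygon_edges_from_1: "polygon_edges n \<pi> = chain_edges R \<union> chain_edges S"
  by (auto simp: polygon_edges_eq lr_minima_eq dest: chain_edgesD(1-3))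

lemma R_increasing: "p \<in> R \<Longrightarrow> q \<in> R \<Longrightarrow> fst p < fst q \<Longrightarrow> snd p < snd q"
  using neq[of "fst p" "fst q"] by (force simp: rl_minima_iff perm_points_iff le_less)

lemma chain_R_subset_I: "chain_edges R \<subseteq> I"
proof safe
  fix p q assume "(p, q) \<in> chain_edges R"
  then show "(p, q) \<in> I"
    using R_increasing[of p q] chain_edgesD(1-3)[of p q R]
    by (auto simp: increasing_edges_def polygon_edges_from_1)
qed

text \<open>The counterpart of \<open>source_edge_continues\<close>: an inner vertex of the chain of
  \<open>R\<close> is a right-left minimum away from the ends, hence no source.\<close>

lemma R_edge_continues:
  assumes "(p, q) \<in> chain_edges R" "(q, r) \<in> polygon_edges n \<pi>"
  shows "(q, r) \<in> chain_edges R"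
proof -
  have "(p, q) \<in> polygon_edges n \<pi>" using assms by (simp add: polygon_edges_eq)
  then have "q \<in> R" "1 < fst q" "fst q < n"
    using chain_edgesD(2)[OF assms(1)] polygon_edgesD(3,4)[of p q n \<pi>]
      polygon_edgesD(3,5)[OF assms(2)] by auto
  then have "q \<notin> S" by (auto simp: in_S_iff)
  then show ?thesis
    using assms(2) chain_edgesD(1) unfolding polygon_edges_from_1 by blast
qed

lemma path_in_R: "is_path I es \<Longrightarrow> hd es \<in> chain_edges R \<Longrightarrow> set es \<subseteq> chain_edges R"
  using is_path_stays_in[of I es "chain_edges R"] R_edge_continues increasing_subset_polygon_edges by blast

lemma path_in_S: "is_path I es \<Longrightarrow> hd es \<in> chain_edges S \<Longrightarrow> set es \<subseteq> chain_edges S"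
  using is_path_stays_in[of I es "chain_edges S"] source_edge_continues increasing_subset_polygon_edges by blast

text \<open>The lowest point \<open>(k, \<pi> k)\<close> to the right of \<open>p\<close> is a right-left minimum below \<open>p\<close>, and up to
  abscissa \<open>k\<close> the increasing line through the right-left minima does not exceed \<open>\<pi> k\<close>.\<close>

lemma not_on_R_line:
  assumes "p \<in> P" "p \<notin> R" "set es \<subseteq> chain_edges R"
  shows "plane_point p \<notin> path_line es"
proof
  assume "plane_point p \<in> path_line es"
  then obtain a b where ab: "(a, b) \<in> chain_edges R"
    and seg: "plane_point p \<in> closed_segment (plane_point a) (plane_point b)"
    using assms(3) unfolding path_line_def by blast
  obtain j where j: "fst p < j" "j \<le> n" "\<pi> j < snd p"
    using assms(1,2) by (auto simp: rl_minima_iff not_le)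
  obtain k where k: "fst p < k \<and> k \<le> n" "\<And>l. fst p < l \<and> l \<le> n \<Longrightarrow> \<pi> k \<le> \<pi> l"
    using ex_has_least_nat[of "\<lambda>k. fst p < k \<and> k \<le> n" j \<pi>] j by blast
  have kR: "(k, \<pi> k) \<in> R"
    using k by (auto simp: rl_minima_iff perm_points_iff)
  note ab' = chain_edgesD[OF ab]
  have "fst a \<le> fst p"
    using segment_bounds(1)[OF seg] ab'(3) by (simp add: plane_point_def)
  \<comment> \<open>Consecutive points \<open>a\<close> and \<open>b\<close> have no right-left
    minimum between them, so the one at \<open>k\<close>, which lies to the right of
    \<open>a\<close>, cannot lie to the left of \<open>b\<close>.\<close>
  then have "fst b \<le> k" using ab'(4)[OF kR] k(1) by auto
  then have "snd b \<le> \<pi> k" using R_increasing[OF ab'(2) kR] perm_points_eqI[of b n \<pi> "(k, \<pi> k)"]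
      ab'(2) kR by (cases "fst b = k") (auto simp: rl_minima_iff perm_points_iff)
  moreover have "snd p \<le> snd b"
    using segment_bounds(4)[OF seg] R_increasing[OF ab'(1,2,3)] by (simp add: plane_point_def)
  ultimately show False using k(2)[of j] j by simp
qed

lemma first_edge:
  assumes "(1, 1) \<in> X" "(n, \<pi> n) \<in> X"
  obtains q where "((1, 1), q) \<in> chain_edges X"
  using ex_chain_edge_right[OF assms] two_le by auto

lemma first_edge_increasing:
  assumes "((1, 1), q) \<in> polygon_edges n \<pi>"
  shows "((1, 1), q) \<in> I"
  using assms polygon_edgesD[OF assms] gt_1[of "fst q"]
  by (auto simp: increasing_edges_def perm_points_iff)

text \<open>Both chains leave \<open>(1, 1)\<close> upwards, which gives increasing paths
  \<open>r\<close> and \<open>s\<close> besides the decreasing path \<open>d\<close>. The end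
  \<open>b\<close> of the first source edge separates \<open>r\<close> from \<open>s\<close>: it
  lies on \<open>s\<close>, but off the line through the right-left minima.\<close>

lemma decreasing_source_edge_not_parallel:
  assumes "(p, q) \<in> chain_edges S" "snd q < snd p"
  shows "card (faces n \<pi>) \<noteq> 2"
proof -
  have pq: "(p, q) \<in> D" using assms by (auto simp: decreasing_edges_def polygon_edges_from_1)
  obtain d where d: "maximal_path D d" using ex_maximal_path_polygon[OF pq decreasing_subset_polygon_edges] by blast
  obtain a where a: "((1, 1), a) \<in> chain_edges R" by (rule first_edge[OF ends(1,2)])
  obtain b where b: "((1, 1), b) \<in> chain_edges S" by (rule first_edge[OF ends(3,4)])
  have "((1, 1), a) \<in> I" "((1, 1), b) \<in> I"
    using a b first_edge_increasing by (auto simp: polygon_edges_from_1)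
  then obtain r s where r: "maximal_path I r" "((1, 1), a) \<in> set r"
    and s: "maximal_path I s" "((1, 1), b) \<in> set s"
    by (metis ex_maximal_path_polygon increasing_subset_polygon_edges)
  have rp: "is_path I r" and sp: "is_path I s" and dp: "is_path D d"
    using r s d by (auto simp: maximal_path_def)
  have "hd r = ((1, 1), a)"
    by (rule path_hd_eq[OF rp increasing_subset_polygon_edges r(2)]) simp
  then have R: "set r \<subseteq> chain_edges R" using path_in_R[OF rp] a by simp
  note pq' = chain_edgesD[OF assms(1)] and b' = chain_edgesD[OF b]
  have "fst p \<noteq> 1"
  proof
    assume "fst p = 1"
    then have "snd p = 1" using pq'(1) at_1 by (auto simp: in_S_iff perm_points_iff)
    then show False using assms(2) pq'(2) permutes_Icc_bounds(1)[OF permutes, of "fst q"]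
      by (auto simp: in_S_iff perm_points_iff)
  qed
  then have "1 < fst p" using pq'(1) by (auto simp: in_S_iff perm_points_iff)
  \<comment> \<open>No source lies strictly between \<open>(1, 1)\<close> and \<open>b\<close>, so
    \<open>b\<close> is not beyond \<open>p\<close>, which in turn is left of \<open>q\<close>. Thus
    the abscissa of \<open>b\<close> is interior, and \<open>b\<close>, being a source there, is
    outside \<open>R\<close>.\<close>
  then have "fst b \<le> fst p" using b'(4)[OF pq'(1)] by simp
  moreover have "fst q \<le> n" using pq'(2) by (auto simp: in_S_iff perm_points_iff)
  ultimately have "b \<in> P" "b \<notin> R" using b' pq'(3) by (auto simp: in_S_iff)
  then have "plane_point b \<notin> path_line r" by (rule not_on_R_line) (rule R)
  moreover have "plane_point b \<in> path_line s" using plane_point_in_path_line s(2) by blast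
  moreover have "path_line r \<noteq> path_line d" "path_line s \<noteq> path_line d"
    using increasing_path_line_neq_decreasing rp sp dp by blast+
  moreover have "path_line r \<in> faces n \<pi>" "path_line d \<in> faces n \<pi>" "path_line s \<in> faces n \<pi>"
    using d r s by (auto simp: faces_def)
  ultimately show ?thesis by (metis card_neq_2)
qed

section \<open>All source edges increasing\<close>

context
  assumes S_inc: "\<And>p q. (p, q) \<in> chain_edges S \<Longrightarrow> snd p < snd q"
begin

lemma I_eq: "I = chain_edges R \<union> chain_edges S"
  using S_inc chain_R_subset_I
  by (auto simp: increasing_edges_def polygon_edges_from_1)

lemma D_empty: "D = {}"
proof -
  have "(p, q) \<notin> D" for p q
    using S_inc[of p q] R_increasing[of p q] chain_edgesD(1-3)[of p q R]
    by (auto simp: decreasing_edges_def polygon_edges_from_1)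
  then show ?thesis by auto
qed

lemma faces_eq: "faces n \<pi> = path_line ` {es. maximal_path I es}"
  by (auto simp: faces_def D_empty maximal_path_def is_path_iff)

text \<open>Both chains contain \<open>(1, 1)\<close>, so a vertex with larger abscissa has a
  predecessor in its own chain. All edges increase here, so this predecessor would extend the
  path.\<close>

lemma maximal_path_starts:
  assumes "maximal_path I es"
  shows "fst (fst (hd es)) = 1"
proof (rule ccontr)
  assume *: "fst (fst (hd es)) \<noteq> 1"
  have "hd es \<in> I" using assms by (cases es) (auto simp: maximal_path_def is_path_iff)
  then have hd: "(fst (hd es), snd (hd es)) \<in> chain_edges R \<union> chain_edges S" using I_eq by simp
  then have "1 < fst (fst (hd es))"
    using polygon_edgesD(4)[of "fst (hd es)" "snd (hd es)" n \<pi>] * by (auto simp: polygon_edges_from_1)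
  then obtain p where "(p, fst (hd es)) \<in> chain_edges R \<union> chain_edges S"
    using hd ex_chain_edge_left[of "fst (hd es)" R "(1, 1)"] ends
      ex_chain_edge_left[of "fst (hd es)" S "(1, 1)"] chain_edgesD(1) by (metis UnE UnI1 UnI2 fst_conv)
  then show False using maximal_path_hd[OF assms] I_eq by fastforce
qed

lemma maximal_path_ends:
  assumes "maximal_path I es"
  shows "fst (snd (last es)) = n"
proof (rule ccontr)
  assume *: "fst (snd (last es)) \<noteq> n"
  have "last es \<in> I" using assms last_in_set[of es] by (auto simp: maximal_path_def is_path_iff)
  then have la: "(fst (last es), snd (last es)) \<in> chain_edges R \<union> chain_edges S" using I_eq by simp
  then have "fst (snd (last es)) < n"
    using polygon_edgesD(5)[of "fst (last es)" "snd (last es)" n \<pi>] * by (auto simp: polygon_edges_from_1)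
  then obtain p where "(snd (last es), p) \<in> chain_edges R \<union> chain_edges S"
    using la ex_chain_edge_right[of "snd (last es)" R "(n, \<pi> n)"] ends
      ex_chain_edge_right[of "snd (last es)" S "(n, \<pi> n)"] chain_edgesD(2) by (metis UnE UnI1 UnI2 fst_conv)
  then show False using maximal_path_last[OF assms] I_eq by fastforce
qed

text \<open>A maximal path runs from abscissa \<open>1\<close> to abscissa \<open>n\<close>, hence
  passes over the abscissa of every point of \<open>X\<close>; an edge joining consecutive points of
  \<open>X\<close> cannot jump over such a point.\<close>

lemma path_covers_chain:
  assumes "maximal_path I es" "set es \<subseteq> chain_edges X" "X \<subseteq> P"
  shows "set es = chain_edges X"
proof -
  have "(p, q) \<in> set es" if pq: "(p, q) \<in> chain_edges X" for p q
  proof -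
    note pq' = chain_edgesD[OF pq]
    have "p \<in> P" "q \<in> P" using pq' assms(3) by auto
    then have "fst (fst (hd es)) \<le> fst p" "fst p < fst (snd (last es))"
      using maximal_path_starts[OF assms(1)] maximal_path_ends[OF assms(1)] pq'(3)
      by (auto simp: perm_points_iff)
    moreover have "is_path I es" using assms(1) by (simp add: maximal_path_def)
    ultimately obtain a b where ab: "(a, b) \<in> set es" "fst a \<le> fst p" "fst p < fst b"
      using is_path_crosses[of I es fst "fst p"] by blast
    have "(a, b) \<in> chain_edges X" using ab assms(2) by blast
    note ab' = chain_edgesD[OF this]
    \<comment> \<open>The abscissa of \<open>p\<close> lies in the half-open interval from
      \<open>a\<close> to \<open>b\<close>, and no point of \<open>X\<close> lies strictly inside
      it.\<close>
    have "fst p = fst a" using ab'(4)[OF pq'(1)] ab by simp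
    then have "p = a" using pq'(1) ab'(1) assms(3) perm_points_eqI by blast
    moreover have "fst q = fst b"
      using ab'(4)[OF pq'(2)] pq'(4)[OF ab'(2)] ab'(3) pq'(3) \<open>fst p = fst a\<close> by linarith
    then have "q = b" using pq'(2) ab'(2) assms(3) perm_points_eqI by blast
    ultimately show ?thesis using ab(1) by simp
  qed
  then show ?thesis using assms(2) by auto
qed

lemma maximal_path_cases:
  assumes "maximal_path I es"
  shows "set es = chain_edges R \<or> set es = chain_edges S"
proof -
  have es: "is_path I es" using assms by (simp add: maximal_path_def)
  then have "hd es \<in> chain_edges R \<union> chain_edges S" by (cases es) (auto simp: is_path_iff I_eq)
  then show ?thesis
    using path_in_R[OF es] path_in_S[OF es] path_covers_chain[OF assms] minima_subset_perm_points
    by blast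
qed

text \<open>A point \<open>p\<close> outside \<open>R\<close> is a source other than the two end
  points. It lies on the line through the sources and not on that through \<open>R\<close>, so the
  two lines are different.\<close>

lemma card_faces_nonidentity:
  assumes p: "p \<in> P" "p \<notin> R"
  shows "card (faces n \<pi>) = 2"
proof -
  obtain a where a: "((1, 1), a) \<in> chain_edges R" by (rule first_edge[OF ends(1,2)])
  obtain b where b: "((1, 1), b) \<in> chain_edges S" by (rule first_edge[OF ends(3,4)])
  have aI: "((1, 1), a) \<in> I" and bI: "((1, 1), b) \<in> I" using a b by (auto simp: I_eq)
  obtain r where r: "maximal_path I r" "((1, 1), a) \<in> set r"
    using ex_maximal_path_polygon[OF aI increasing_subset_polygon_edges] .
  obtain s where s: "maximal_path I s" "((1, 1), b) \<in> set s"
    using ex_maximal_path_polygon[OF bI increasing_subset_polygon_edges] .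
  have rp: "is_path I r" and sp: "is_path I s"
    using r s by (auto simp: maximal_path_def)
  have "hd r = ((1, 1), a)" "hd s = ((1, 1), b)"
    using path_hd_eq[OF rp increasing_subset_polygon_edges r(2)]
      path_hd_eq[OF sp increasing_subset_polygon_edges s(2)] by auto
  then have R: "set r = chain_edges R" and S: "set s = chain_edges S"
    using path_in_R[OF rp] path_in_S[OF sp] path_covers_chain r(1) s(1) a b minima_subset_perm_points
    by metis+
  have "p \<in> S" using p by (simp add: in_S_iff)
  moreover have "fst p \<noteq> n" using p ends(2) perm_points_eqI[of p n \<pi> "(n, \<pi> n)"]
    by (auto simp: rl_minima_iff)
  ultimately obtain q where "(p, q) \<in> chain_edges S"
    using ex_chain_edge_right[of p S "(n, \<pi> n)"] ends(4) p by (auto simp: perm_points_iff)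
  then have "plane_point p \<in> path_line s" using S plane_point_in_path_line by blast
  moreover have "plane_point p \<notin> path_line r" by (rule not_on_R_line) (use p R in auto)
  ultimately have ne: "path_line r \<noteq> path_line s" by blast
  \<comment> \<open>A line depends only on the set of edges of its path, and by
    \<open>maximal_path_cases\<close> only two such sets occur.\<close>
  have "path_line es \<in> {path_line r, path_line s}" if "maximal_path I es" for es
    using maximal_path_cases[OF that] R S by (auto simp: path_line_def)
  then have "faces n \<pi> = {path_line r, path_line s}"
    using r s by (auto simp: faces_eq)
  then show ?thesis using ne by simp
qed

text \<open>All vertices lie on the diagonal, and each maximal path reaches from abscissa
  \<open>1\<close> to abscissa \<open>n\<close>. Every path therefore draws the same diagonal
  segment, and at most one face remains.\<close>

lemma card_faces_identity:
  assumes "\<pi> = id"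
  shows "card (faces n \<pi>) \<noteq> 2"
proof -
  let ?L = "{(t, t) | t::real. 1 \<le> t \<and> t \<le> real n}"
  have "path_line es = ?L" if es: "maximal_path I es" for es
  proof -
    have ip: "is_path I es" using es by (simp add: maximal_path_def)
    have edge: "closed_segment (plane_point p) (plane_point q) = {(t, t) | t. real (fst p) \<le> t \<and> t \<le> real (fst q)}"
      "1 \<le> fst p" "fst q \<le> n" if "(p, q) \<in> set es" for p q
    proof -
      have "(p, q) \<in> polygon_edges n \<pi>"
        using that ip increasing_subset_polygon_edges by (auto simp: is_path_iff)
      note pq = polygon_edgesD[OF this]
      then show "1 \<le> fst p" "fst q \<le> n" by auto
      have diag: "plane_point p = (real (fst p), real (fst p))" "plane_point q = (real (fst q), real (fst q))"
        using pq(1,2) assms by (auto simp: perm_points_iff plane_point_def)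
      have "closed_segment (plane_point p) (plane_point q) = (\<lambda>t. (t, t)) ` closed_segment (real (fst p)) (real (fst q))"
        unfolding diag closed_segment_def by (auto simp: image_iff)
      then show "closed_segment (plane_point p) (plane_point q) = {(t, t) | t. real (fst p) \<le> t \<and> t \<le> real (fst q)}"
        using pq(3) by (auto simp: closed_segment_eq_real_ivl)
    qed
    have "(t, t) \<in> path_line es" if t: "1 \<le> t" "t \<le> real n" for t
    \<comment> \<open>The crossing argument yields half-open intervals, which miss the right end;
      there the last edge of the path takes over.\<close>
    proof (cases "t = real n")
      case True
      have ne: "es \<noteq> []" using ip by (simp add: is_path_iff)
      obtain p q where pq: "last es = (p, q)" by (cases "last es") blast
      then have "(p, q) \<in> set es" using last_in_set[OF ne] by simp
      moreover have "fst q = n" using maximal_path_ends[OF es] pq by simp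
      moreover have "fst p \<le> fst q"
      proof -
        have "(p, q) \<in> polygon_edges n \<pi>"
          using \<open>(p, q) \<in> set es\<close> ip increasing_subset_polygon_edges by (auto simp: is_path_iff)
        then show ?thesis using polygon_edgesD(3) by fastforce
      qed
      ultimately have "(t, t) \<in> closed_segment (plane_point p) (plane_point q)"
        using edge(1) True by simp
      then show ?thesis using \<open>(p, q) \<in> set es\<close> unfolding path_line_def by blast
    next
      case False
      then have "\<exists>(p, q)\<in>set es. real (fst p) \<le> t \<and> t < real (fst q)"
        using t maximal_path_starts[OF es] maximal_path_ends[OF es]
        by (intro is_path_crosses[OF ip]) auto
      then obtain p q where "(p, q) \<in> set es" "real (fst p) \<le> t" "t < real (fst q)" by blast
      then have "(t, t) \<in> closed_segment (plane_point p) (plane_point q)"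
        using edge(1) by simp
      then show ?thesis using \<open>(p, q) \<in> set es\<close> unfolding path_line_def by blast
    qed
    moreover have "z \<in> ?L" if "z \<in> path_line es" for z
    proof -
      obtain p q where pq: "(p, q) \<in> set es" "z \<in> closed_segment (plane_point p) (plane_point q)"
        using \<open>z \<in> path_line es\<close> unfolding path_line_def by blast
      have "real (fst q) \<le> real n" "1 \<le> real (fst p)" using edge(2,3)[OF pq(1)] by auto
      then show ?thesis using edge(1)[OF pq(1)] pq(2) by auto
    qed
    ultimately show ?thesis by auto
  qed
  then have "faces n \<pi> \<subseteq> {?L}" by (auto simp: faces_eq)
  then have "card (faces n \<pi>) \<le> 1" using card_mono[of "{?L}"] by fastforce
  then show ?thesis by simp
qed

lemma S_increasing:
  assumes "p \<in> S" "q \<in> S" "fst p < fst q"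
  shows "snd p < snd q"
  using assms
proof (induction "fst q - fst p" arbitrary: p q rule: less_induct)
  case less
  show ?case
  proof (cases "(p, q) \<in> chain_edges S")
    case False
    then obtain r where r: "r \<in> S" "fst p < fst r" "fst r < fst q"
      using chain_edgesI[of p S q] less.prems by (meson not_le)
    then have "snd p < snd r" "snd r < snd q"
      using less.hyps[of r p] less.hyps[of q r] less.prems by auto
    then show ?thesis by simp
  qed (rule S_inc)
qed

end

section \<open>The order of the sources and the pattern 321\<close>

lemma increasing_imp_id:
  assumes "P \<subseteq> R"
  shows "\<pi> = id"
\<comment> \<open>If every point is a right-left minimum, then \<open>\<pi>\<close> increases, so
  \<open>i \<le> \<pi> i\<close> throughout, and a permutation that moves no letter down is the
  identity.\<close>
proof (rule permutes_natset_ge[OF permutes])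
  have "i \<le> n \<longrightarrow> i \<le> \<pi> i" if "1 \<le> i" for i
    using that
  proof (induction rule: dec_induct)
    case (step i)
    have "\<pi> i < \<pi> (Suc i)" if "Suc i \<le> n"
      using R_increasing[of "(i, \<pi> i)" "(Suc i, \<pi> (Suc i))"] assms that step
      by (auto simp: perm_points_iff subset_iff)
    then show ?case using step by auto
  qed (use at_1 in simp)
  then show "\<forall>i\<in>{1..n}. i \<le> \<pi> i" by simp
qed

text \<open>A point with a smaller value to its right is no right-left minimum, hence a source. So
  the first two letters of a pattern 321 are sources in decreasing order, and if
  \<open>\<pi> n \<noteq> n\<close>, the value \<open>n\<close> is a source above the last one.
  Conversely, an interior source \<open>q\<close> has a smaller value to its right, which would
  complete a descent from \<open>p\<close> to \<open>q\<close> to a pattern 321.\<close>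

lemma sources_increasing_iff:
  "(\<forall>p\<in>S. \<forall>q\<in>S. fst p < fst q \<longrightarrow> snd p < snd q) \<longleftrightarrow>
     \<pi> n = n \<and> (\<forall>i j k. 1 \<le> i \<and> i < j \<and> j < k \<and> k \<le> n \<longrightarrow> \<not> (\<pi> j < \<pi> i \<and> \<pi> k < \<pi> j))"
  (is "?L \<longleftrightarrow> ?R")
proof
  assume inc: ?L
  have src: "(i, \<pi> i) \<in> S" if "1 \<le> i" "i < k" "k \<le> n" "\<pi> k < \<pi> i" for i k
    using that by (auto simp: in_S_iff rl_minima_iff perm_points_iff)
  have "\<not> (\<pi> j < \<pi> i \<and> \<pi> k < \<pi> j)" if "1 \<le> i" "i < j" "j < k" "k \<le> n" for i j k
  proof
    assume *: "\<pi> j < \<pi> i \<and> \<pi> k < \<pi> j"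
    have "(i, \<pi> i) \<in> S" "(j, \<pi> j) \<in> S" using src[of i j] src[of j k] that * by auto
    then show False using inc that * by fastforce
  qed
  moreover have "\<pi> n = n"
  proof (rule ccontr)
    assume "\<pi> n \<noteq> n"
    have "n \<in> \<pi> ` {1..n}" using permutes_image[OF permutes] two_le by simp
    then obtain k where k: "1 \<le> k" "k \<le> n" "\<pi> k = n" by auto
    with \<open>\<pi> n \<noteq> n\<close> have "k < n" by (cases "k = n") auto
    moreover have "\<pi> n < n" using permutes_Icc_bounds(2)[OF permutes, of n] \<open>\<pi> n \<noteq> n\<close> two_le by simp
    ultimately have "(k, \<pi> k) \<in> S" using src[of k n] k by simp
    then show False using inc ends(4) \<open>k < n\<close> \<open>\<pi> n < n\<close> k by fastforce
  qed
  ultimately show ?R by blast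
next
  assume R: ?R
  have "snd p < snd q" if pq: "p \<in> S" "q \<in> S" "fst p < fst q" for p q
  proof -
    have pts: "1 \<le> fst p" "fst q \<le> n" "snd p = \<pi> (fst p)" "snd q = \<pi> (fst q)"
      using pq by (auto simp: in_S_iff perm_points_iff)
    have "fst q \<noteq> 1" using pts pq(3) by simp
    then consider "fst p = 1" | "fst q = n" | "q \<notin> R" using pq(2)
      unfolding in_S_iff by blast
    then show ?thesis
    proof cases
      case 1
      then show ?thesis using gt_1[of "fst q"] at_1 pq(3) pts by simp
    next
      case 2
      then show ?thesis
        using R permutes_Icc_bounds(2)[OF permutes, of "fst p"] neq[of "fst p" n] pq(3) pts by auto
    next
      case 3
      then obtain k where k: "fst q < k" "k \<le> n" "\<pi> k < snd q"
        using pq(2) by (auto simp: rl_minima_iff in_S_iff not_le)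
      have "\<not> (\<pi> (fst q) < \<pi> (fst p) \<and> \<pi> k < \<pi> (fst q))" using R k pts pq(3) by blast
      then show ?thesis using k pts neq[of "fst p" "fst q"] pq(3) by auto
    qed
  qed
  then show ?L by blast
qed

lemma card_faces_eq_2_iff:
  "card (faces n \<pi>) = 2 \<longleftrightarrow> \<pi> \<noteq> id \<and> \<pi> n = n \<and>
     (\<forall>i j k. 1 \<le> i \<and> i < j \<and> j < k \<and> k \<le> n \<longrightarrow> \<not> (\<pi> j < \<pi> i \<and> \<pi> k < \<pi> j))"
proof
  assume 2: "card (faces n \<pi>) = 2"
  have inc: "snd p < snd q" if "(p, q) \<in> chain_edges S" for p q
  proof (rule ccontr)
    assume "\<not> snd p < snd q"
    moreover have "snd p \<noteq> snd q"
      using chain_edgesD[OF that] neq[of "fst p" "fst q"] by (auto simp: in_S_iff perm_points_iff)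
    ultimately show False using decreasing_source_edge_not_parallel[OF that] 2 by simp
  qed
  show "\<pi> \<noteq> id \<and> \<pi> n = n \<and>
     (\<forall>i j k. 1 \<le> i \<and> i < j \<and> j < k \<and> k \<le> n \<longrightarrow> \<not> (\<pi> j < \<pi> i \<and> \<pi> k < \<pi> j))"
    unfolding sources_increasing_iff[symmetric]
    using S_increasing[OF inc] card_faces_identity[OF inc] 2 by blast
next
  assume *: "\<pi> \<noteq> id \<and> \<pi> n = n \<and>
     (\<forall>i j k. 1 \<le> i \<and> i < j \<and> j < k \<and> k \<le> n \<longrightarrow> \<not> (\<pi> j < \<pi> i \<and> \<pi> k < \<pi> j))"
  then have "snd p < snd q" if "(p, q) \<in> chain_edges S" for p q
    using chain_edgesD[OF that] unfolding sources_increasing_iff[symmetric] by blast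
  moreover obtain p where "p \<in> P" "p \<notin> R" using increasing_imp_id * by blast
  ultimately show "card (faces n \<pi>) = 2" using card_faces_nonidentity by blast
qed

end

section \<open>Reflection\<close>

definition mirror_perm :: "nat \<Rightarrow> (nat \<Rightarrow> nat) \<Rightarrow> nat \<Rightarrow> nat" where
  "mirror_perm n \<pi> i = (if i \<in> {1..n} then \<pi> (Suc n - i) else i)"

definition mirror_point :: "nat \<Rightarrow> point \<Rightarrow> point" where
  "mirror_point n p = (Suc n - fst p, snd p)"

text \<open>The end points are exchanged because edges are recorded from left to right and the
  reflection reverses that direction.\<close>

definition mirror_edge :: "nat \<Rightarrow> edge \<Rightarrow> edge" where
  "mirror_edge n e = (mirror_point n (snd e), mirror_point n (fst e))"

definition mirror_plane :: "nat \<Rightarrow> real \<times> real \<Rightarrow> real \<times> real" where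
  "mirror_plane n z = (real (Suc n) - fst z, snd z)"

lemma mirror_perm_permutes:
  assumes "\<pi> permutes {1..n}"
  shows "mirror_perm n \<pi> permutes {1..n}"
proof -
  have "bij_betw (\<lambda>i. Suc n - i) {1..n} {1..n}"
    by (rule bij_betwI[where g = "\<lambda>i. Suc n - i"]) auto
  then have "bij_betw (\<pi> \<circ> (\<lambda>i. Suc n - i)) {1..n} {1..n}"
    using permutes_imp_bij[OF assms] by (rule bij_betw_trans)
  then have "bij_betw (mirror_perm n \<pi>) {1..n} {1..n}"
    by (rule bij_betw_cong[THEN iffD1, rotated]) (simp add: mirror_perm_def)
  then show ?thesis by (rule bij_imp_permutes) (auto simp: mirror_perm_def)
qed

lemma mirror_perm_mirror_perm:
  assumes "\<pi> permutes {1..n}"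
  shows "mirror_perm n (mirror_perm n \<pi>) = \<pi>"
proof
  fix i
  show "mirror_perm n (mirror_perm n \<pi>) i = \<pi> i"
    using permutes_not_in[OF assms, of i] by (auto simp: mirror_perm_def)
qed

lemma mirror_point_mirror_point: "fst p \<le> n \<Longrightarrow> mirror_point n (mirror_point n p) = p"
  by (simp add: mirror_point_def)

lemma mirror_point_in_perm_points:
  assumes "p \<in> perm_points n \<pi>"
  shows "mirror_point n p \<in> perm_points n (mirror_perm n \<pi>)"
  using assms by (auto simp: perm_points_iff mirror_point_def mirror_perm_def)

lemma mirror_point_lr_minima:
  assumes "p \<in> lr_minima n \<pi>"
  shows "mirror_point n p \<in> rl_minima n (mirror_perm n \<pi>)"
proof -
  have "snd p \<le> mirror_perm n \<pi> i" if "Suc n - fst p < i" "i \<le> n" for i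
  proof -
    have "1 \<le> i" "1 \<le> Suc n - i" "Suc n - i < fst p" using that by auto
    then show ?thesis using assms that(2) by (simp add: lr_minima_iff mirror_perm_def)
  qed
  then show ?thesis
    using assms mirror_point_in_perm_points[of p n \<pi>]
    by (auto simp: lr_minima_iff rl_minima_iff mirror_point_def)
qed

lemma mirror_point_rl_minima:
  assumes "p \<in> rl_minima n \<pi>"
  shows "mirror_point n p \<in> lr_minima n (mirror_perm n \<pi>)"
proof -
  have "snd p \<le> mirror_perm n \<pi> i" if "1 \<le> i" "i < Suc n - fst p" for i
  proof -
    have "i \<le> n" "Suc n - i \<le> n" "fst p < Suc n - i" using that by auto
    then show ?thesis using assms that(1) by (simp add: rl_minima_iff mirror_perm_def)
  qed
  then show ?thesis
    using assms mirror_point_in_perm_points[of p n \<pi>]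
    by (auto simp: lr_minima_iff rl_minima_iff mirror_point_def)
qed

text \<open>Interior sources are defined by not being minima, so the facts about minima are needed
  for the mirrored permutation and are carried back by the involution.\<close>

lemma mirror_point_sources:
  assumes \<pi>: "\<pi> permutes {1..n}" and p: "p \<in> sources n \<pi>"
  shows "mirror_point n p \<in> sources n (mirror_perm n \<pi>)"
proof -
  have P: "p \<in> perm_points n \<pi>" using p by (simp add: sources_iff)
  then have inv: "mirror_point n (mirror_point n p) = p"
    by (simp add: mirror_point_mirror_point perm_points_iff)
  have "mirror_point n p \<in> rl_minima n (mirror_perm n \<pi>) \<Longrightarrow> p \<in> lr_minima n \<pi>"
    "mirror_point n p \<in> lr_minima n (mirror_perm n \<pi>) \<Longrightarrow> p \<in> rl_minima n \<pi>"
    using mirror_point_rl_minima[of "mirror_point n p" n "mirror_perm n \<pi>"]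
      mirror_point_lr_minima[of "mirror_point n p" n "mirror_perm n \<pi>"]
    by (simp_all add: inv mirror_perm_mirror_perm[OF \<pi>])
  moreover have "fst p = 1 \<or> fst p = n \<Longrightarrow> fst (mirror_point n p) = 1 \<or> fst (mirror_point n p) = n"
    by (auto simp: mirror_point_def)
  ultimately show ?thesis
    using p mirror_point_in_perm_points[OF P] by (auto simp: sources_iff)
qed

text \<open>Both inclusions between \<open>S\<close> and \<open>T\<close> enter: one places the
  mirrored end points in \<open>T\<close>, the other sends a point of \<open>T\<close> between them
  back to a point of \<open>S\<close> between \<open>p\<close> and \<open>q\<close>.\<close>

lemma mirror_edge_chain:
  assumes "(p, q) \<in> chain_edges S" "\<And>r. r \<in> S \<Longrightarrow> fst r \<le> n"
    and "\<And>r. r \<in> S \<Longrightarrow> mirror_point n r \<in> T" "\<And>r. r \<in> T \<Longrightarrow> mirror_point n r \<in> S"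
  shows "mirror_edge n (p, q) \<in> chain_edges T"
proof -
  note pq = chain_edgesD[OF assms(1)]
  have "fst r \<le> fst (mirror_point n q) \<or> fst (mirror_point n p) \<le> fst r" if "r \<in> T" for r
    using pq(4)[OF assms(4)[OF that]] assms(2)[OF pq(2)] pq(3) by (auto simp: mirror_point_def)
  moreover have "fst (mirror_point n q) < fst (mirror_point n p)"
    using pq(3) assms(2)[OF pq(2)] by (auto simp: mirror_point_def)
  ultimately show ?thesis
    using assms(3)[OF pq(1)] assms(3)[OF pq(2)]
    unfolding mirror_edge_def by (auto intro!: chain_edgesI)
qed

lemma mirror_edge_polygon:
  assumes \<pi>: "\<pi> permutes {1..n}" and pq: "(p, q) \<in> polygon_edges n \<pi>"
  shows "mirror_edge n (p, q) \<in> polygon_edges n (mirror_perm n \<pi>)"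
proof -
  note \<pi>' = mirror_perm_permutes[OF \<pi>] and inv = mirror_perm_mirror_perm[OF \<pi>]
  have le: "fst r \<le> n" if "r \<in> lr_minima n \<pi> \<or> r \<in> rl_minima n \<pi> \<or> r \<in> sources n \<pi>" for r
    using that by (auto simp: lr_minima_iff rl_minima_iff sources_iff perm_points_iff)
  consider "(p, q) \<in> chain_edges (lr_minima n \<pi>)" | "(p, q) \<in> chain_edges (rl_minima n \<pi>)"
    | "(p, q) \<in> chain_edges (sources n \<pi>)"
    using pq by (auto simp: polygon_edges_eq)
  then show ?thesis
  proof cases
    case 1
    then have "mirror_edge n (p, q) \<in> chain_edges (rl_minima n (mirror_perm n \<pi>))"
      by (rule mirror_edge_chain)
        (use le mirror_point_lr_minima mirror_point_rl_minima[of _ n "mirror_perm n \<pi>"] inv in auto)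
    then show ?thesis by (simp add: polygon_edges_eq)
  next
    case 2
    then have "mirror_edge n (p, q) \<in> chain_edges (lr_minima n (mirror_perm n \<pi>))"
      by (rule mirror_edge_chain)
        (use le mirror_point_rl_minima mirror_point_lr_minima[of _ n "mirror_perm n \<pi>"] inv in auto)
    then show ?thesis by (simp add: polygon_edges_eq)
  next
    case 3
    then have "mirror_edge n (p, q) \<in> chain_edges (sources n (mirror_perm n \<pi>))"
      by (rule mirror_edge_chain)
        (use le mirror_point_sources[OF \<pi>] mirror_point_sources[OF \<pi>'] inv in auto)
    then show ?thesis by (simp add: polygon_edges_eq)
  qed
qed

lemma mirror_edge_increasing_decreasing:
  assumes "\<pi> permutes {1..n}"
  shows "e \<in> increasing_edges n \<pi> \<Longrightarrow> mirror_edge n e \<in> decreasing_edges n (mirror_perm n \<pi>)"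
    and "e \<in> decreasing_edges n \<pi> \<Longrightarrow> mirror_edge n e \<in> increasing_edges n (mirror_perm n \<pi>)"
  using mirror_edge_polygon[OF assms, of "fst e" "snd e"]
  by (auto simp: increasing_edges_def decreasing_edges_def mirror_edge_def mirror_point_def)

lemma mirror_edge_mirror_edge:
  assumes "e \<in> polygon_edges n \<pi>"
  shows "mirror_edge n (mirror_edge n e) = e"
  using polygon_edgesD(3,5)[of "fst e" "snd e" n \<pi>] assms
  by (auto simp: mirror_edge_def mirror_point_mirror_point prod_eq_iff)

lemma is_path_mirror:
  assumes "is_path E es" "\<And>e. e \<in> E \<Longrightarrow> mirror_edge n e \<in> F"
  shows "is_path F (rev (map (mirror_edge n) es))"
proof -
  have "successively (\<lambda>e f. snd (mirror_edge n f) = fst (mirror_edge n e)) es"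
    by (rule successively_mono[where P = "\<lambda>e f. snd e = fst f"])
      (use assms(1) in \<open>auto simp: is_path_iff mirror_edge_def\<close>)
  then show ?thesis
    using assms unfolding is_path_iff by (auto simp: successively_rev successively_map)
qed

text \<open>A path in \<open>F\<close> extending the mirrored path reflects to a path in
  \<open>E\<close> extending \<open>es\<close>, so it is \<open>es\<close> reflected; the order of
  edges is reversed with the direction.\<close>

lemma maximal_path_mirror:
  assumes "maximal_path E es"
    and EF: "\<And>e. e \<in> E \<Longrightarrow> mirror_edge n e \<in> F" and FE: "\<And>e. e \<in> F \<Longrightarrow> mirror_edge n e \<in> E"
    and inv: "\<And>e. e \<in> E \<union> F \<Longrightarrow> mirror_edge n (mirror_edge n e) = e"
  shows "maximal_path F (rev (map (mirror_edge n) es))"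
  unfolding maximal_path_def
proof (intro conjI allI impI; (elim conjE)?)
  have es: "is_path E es" using assms(1) by (simp add: maximal_path_def)
  then show "is_path F (rev (map (mirror_edge n) es))" using EF by (rule is_path_mirror)
  have twice: "rev (map (mirror_edge n) (rev (map (mirror_edge n) xs))) = xs" if "set xs \<subseteq> E \<union> F" for xs
  proof -
    have "map (mirror_edge n \<circ> mirror_edge n) xs = xs"
      using that inv by (intro map_idI) auto
    then show ?thesis by (simp add: rev_map)
  qed
  fix fs assume fs: "is_path F fs" "sublist (rev (map (mirror_edge n) es)) fs"
  have "sublist (rev (map (mirror_edge n) (rev (map (mirror_edge n) es)))) (rev (map (mirror_edge n) fs))"
    using fs(2) by (simp only: sublist_rev map_mono_sublist)
  then have "sublist es (rev (map (mirror_edge n) fs))"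
    using twice[of es] es unfolding is_path_iff by (metis le_supI1)
  moreover have "is_path E (rev (map (mirror_edge n) fs))" using fs(1) FE by (rule is_path_mirror)
  ultimately have "rev (map (mirror_edge n) fs) = es" using assms(1) by (auto simp: maximal_path_def)
  then show "fs = rev (map (mirror_edge n) es)"
    using twice[of fs] fs(1) unfolding is_path_iff by (metis le_supI2)
qed

lemma mirror_plane_segment:
  "mirror_plane n ` closed_segment a b = closed_segment (mirror_plane n a) (mirror_plane n b)"
proof -
  have "mirror_plane n ((1 - u) *\<^sub>R a + u *\<^sub>R b) = (1 - u) *\<^sub>R mirror_plane n a + u *\<^sub>R mirror_plane n b" for u
    by (simp add: mirror_plane_def prod_eq_iff algebra_simps)
  then show ?thesis
    unfolding closed_segment_def setcompr_eq_image image_image by simp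
qed

lemma path_line_mirror:
  assumes "set es \<subseteq> polygon_edges n \<pi>"
  shows "path_line (rev (map (mirror_edge n) es)) = mirror_plane n ` path_line es"
proof -
  have "closed_segment (plane_point (fst (mirror_edge n e))) (plane_point (snd (mirror_edge n e))) =
      mirror_plane n ` closed_segment (plane_point (fst e)) (plane_point (snd e))" if "e \<in> set es" for e
  proof -
    have "(fst e, snd e) \<in> polygon_edges n \<pi>" using that assms by auto
    note e = polygon_edgesD(3,5)[OF this]
    have "plane_point (mirror_point n (fst e)) = mirror_plane n (plane_point (fst e))"
      "plane_point (mirror_point n (snd e)) = mirror_plane n (plane_point (snd e))"
      using e by (auto simp: plane_point_def mirror_point_def mirror_plane_def of_nat_diff)
    then show ?thesis
      by (simp add: mirror_edge_def mirror_plane_segment closed_segment_commute)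
  qed
  then show ?thesis by (auto simp: path_line_def case_prod_unfold image_UN)
qed

lemma mirror_plane_mirror_plane [simp]: "mirror_plane n (mirror_plane n z) = z"
  by (simp add: mirror_plane_def)

lemma mirror_face:
  assumes \<pi>: "\<pi> permutes {1..n}" and "L \<in> faces n \<pi>"
  shows "mirror_plane n ` L \<in> faces n (mirror_perm n \<pi>)"
proof -
  let ?\<pi> = "mirror_perm n \<pi>"
  note \<pi>' = mirror_perm_permutes[OF \<pi>]
  have inv: "mirror_edge n (mirror_edge n e) = e"
    if "e \<in> polygon_edges n \<pi> \<union> polygon_edges n ?\<pi>" for e
    using that mirror_edge_mirror_edge by blast
  note sub = increasing_subset_polygon_edges[of n] decreasing_subset_polygon_edges[of n]
  consider es where "maximal_path (increasing_edges n \<pi>) es" "L = path_line es"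
    | es where "maximal_path (decreasing_edges n \<pi>) es" "L = path_line es"
    using assms(2) by (auto simp: faces_def)
  then show ?thesis
  proof cases
    case 1
    have "maximal_path (decreasing_edges n ?\<pi>) (rev (map (mirror_edge n) es))"
      using 1(1)
    proof (rule maximal_path_mirror)
      show "mirror_edge n e \<in> increasing_edges n \<pi>" if "e \<in> decreasing_edges n ?\<pi>" for e
        using mirror_edge_increasing_decreasing(2)[OF \<pi>' that] by (simp add: mirror_perm_mirror_perm[OF \<pi>])
    qed (use mirror_edge_increasing_decreasing[OF \<pi>] inv sub in blast)+
    moreover have "set es \<subseteq> polygon_edges n \<pi>"
      using 1(1) sub[of \<pi>] unfolding maximal_path_def is_path_iff by blast
    ultimately show ?thesis
      unfolding faces_def 1(2) using path_line_mirror[of es n \<pi>] by (metis (no_types) UnI1 UnI2 imageI mem_Collect_eq)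
  next
    case 2
    have "maximal_path (increasing_edges n ?\<pi>) (rev (map (mirror_edge n) es))"
      using 2(1)
    proof (rule maximal_path_mirror)
      show "mirror_edge n e \<in> decreasing_edges n \<pi>" if "e \<in> increasing_edges n ?\<pi>" for e
        using mirror_edge_increasing_decreasing(1)[OF \<pi>' that] by (simp add: mirror_perm_mirror_perm[OF \<pi>])
    qed (use mirror_edge_increasing_decreasing[OF \<pi>] inv sub in blast)+
    moreover have "set es \<subseteq> polygon_edges n \<pi>"
      using 2(1) sub[of \<pi>] unfolding maximal_path_def is_path_iff by blast
    ultimately show ?thesis
      unfolding faces_def 2(2) using path_line_mirror[of es n \<pi>] by (metis (no_types) UnI1 UnI2 imageI mem_Collect_eq)
  qed
qed

lemma card_faces_mirror_perm:
  assumes \<pi>: "\<pi> permutes {1..n}"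
  shows "card (faces n (mirror_perm n \<pi>)) = card (faces n \<pi>)"
proof -
  have "bij_betw ((`) (mirror_plane n)) (faces n \<pi>) (faces n (mirror_perm n \<pi>))"
    using mirror_face[OF \<pi>] mirror_face[OF mirror_perm_permutes[OF \<pi>]]
    by (intro bij_betwI[where g = "(`) (mirror_plane n)"])
      (auto simp: mirror_perm_mirror_perm[OF \<pi>] image_image)
  then show ?thesis by (simp add: bij_betw_same_card)
qed

section \<open>Parallel permutations\<close>

text \<open>The middle index of a pattern is never an end. The value \<open>1\<close> at the front
  cannot be the largest letter of a pattern and the value \<open>n\<close> at the back cannot be the
  smallest.\<close>

lemma permutes_fixing_ends_avoiding_321_iff:
  fixes \<pi> :: "nat \<Rightarrow> nat"
  assumes "2 \<le> n"
  shows "\<pi> permutes {1..n} \<and> \<pi> 1 = 1 \<and> \<pi> n = n \<and>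
      (\<forall>i j k. 1 \<le> i \<and> i < j \<and> j < k \<and> k \<le> n \<longrightarrow> \<not> (\<pi> j < \<pi> i \<and> \<pi> k < \<pi> j)) \<longleftrightarrow>
    \<pi> permutes {2..<n} \<and>
      (\<forall>i j k. 2 \<le> i \<and> i < j \<and> j < k \<and> k < n \<longrightarrow> \<not> (\<pi> j < \<pi> i \<and> \<pi> k < \<pi> j))"
    (is "?L \<longleftrightarrow> ?R")
proof
  assume L: ?L
  have "\<pi> permutes {2..<n}"
  proof (rule permutes_superset)
    show "\<pi> permutes {1..n}" using L by blast
    fix x assume "x \<in> {1..n} - {2..<n}"
    then have "x = 1 \<or> x = n" by auto
    then show "\<pi> x = x" using L by blast
  qed
  moreover have "\<not> (\<pi> j < \<pi> i \<and> \<pi> k < \<pi> j)" if "2 \<le> i" "i < j" "j < k" "k < n" for i j k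
  proof -
    have "1 \<le> i" "k \<le> n" using that by auto
    then show ?thesis using L that by blast
  qed
  ultimately show ?R by blast
next
  assume R: ?R
  then have in2: "\<pi> permutes {2..<n}" by blast
  then have p: "\<pi> permutes {1..n}" by (rule permutes_subset) auto
  have ends: "\<pi> 1 = 1" "\<pi> n = n" by (rule permutes_not_in[OF in2]; simp)+
  have "\<not> (\<pi> j < \<pi> i \<and> \<pi> k < \<pi> j)" if "1 \<le> i" "i < j" "j < k" "k \<le> n" for i j k
  proof (cases "i = 1 \<or> k = n")
    case True
    then show ?thesis
      using permutes_Icc_bounds[OF p, of j] ends that by auto
  next
    case False
    then have "2 \<le> i" "k < n" using that by auto
    then show ?thesis using R that by blast
  qed
  then show ?L using p ends by blast
qed

lemma card_parallel_from_1:
  assumes n: "2 \<le> n"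
  shows "real (card {\<pi>. \<pi> permutes {1..n} \<and> \<pi> 1 = 1 \<and> card (faces n \<pi>) = 2}) =
    real ((2 * n - 4) choose (n - 2)) / (real n - 1) - 1" (is "real (card ?Q) = _")
proof -
  \<comment> \<open>The interval \<open>{2..<n}\<close> is written as
    \<open>{2..<2 + (n - 2)}\<close> to match the count with offset \<open>2\<close> and length
    \<open>n - 2\<close>.\<close>
  let ?F = "{\<pi>. \<pi> permutes {2..<2 + (n - 2)} \<and>
      (\<forall>i j k. 2 \<le> i \<and> i < j \<and> j < k \<and> k < 2 + (n - 2) \<longrightarrow> \<not> (\<pi> j < \<pi> i \<and> \<pi> k < \<pi> j))}"
  have n2: "2 + (n - 2) = n" using n by simp
  have "\<pi> \<in> ?Q \<longleftrightarrow> \<pi> \<in> ?F - {id}" for \<pi>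
  proof -
    have "card (faces n \<pi>) = 2 \<longleftrightarrow> \<pi> \<noteq> id \<and> \<pi> n = n \<and>
        (\<forall>i j k. 1 \<le> i \<and> i < j \<and> j < k \<and> k \<le> n \<longrightarrow> \<not> (\<pi> j < \<pi> i \<and> \<pi> k < \<pi> j))"
      if "\<pi> permutes {1..n}" "\<pi> 1 = 1"
      by (rule perm_from_1.card_faces_eq_2_iff) (use that n in \<open>auto simp: perm_from_1_def\<close>)
    then show ?thesis
      using permutes_fixing_ends_avoiding_321_iff[OF n, of \<pi>] unfolding n2 by blast
  qed
  then have Q: "?Q = ?F - {id}" by blast
  have id: "id \<in> ?F" by auto
  have fin: "finite ?F" by (rule finite_subset[OF _ finite_permutations[of "{2..<2 + (n - 2)}"]]) auto
  have "Suc (card ?Q) = card ?F"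
    unfolding Q by (rule card_Suc_Diff1[OF fin id])
  then have "real (card ?Q) = real (card ?F) - 1" by linarith
  also have "real (card ?F) = real ((2 * (n - 2)) choose (n - 2)) / (real (n - 2) + 1)"
    by (rule card_permutes_avoiding_321)
  also have "2 * (n - 2) = 2 * n - 4" by simp
  also have "real (n - 2) + 1 = real n - 1" using n by (simp add: of_nat_diff)
  finally show ?thesis .
qed

theorem theorem3p1:
  fixes n :: nat
  assumes "n \<ge> 2"
  shows "real (card (parallel_permutations n)) =
    2 / (real n - 1) * real ((2 * n - 4) choose (n - 2)) - 2"
proof -
  let ?Q = "\<lambda>k. {\<pi>. \<pi> permutes {1..n} \<and> \<pi> k = 1 \<and> card (faces n \<pi>) = 2}"
  have "\<pi> 1 = 1 \<or> \<pi> n = 1" if \<pi>: "\<pi> permutes {1..n}" "card (faces n \<pi>) = 2" for \<pi>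
  proof -
    have "1 \<in> \<pi> ` {1..n}" using permutes_image[OF \<pi>(1)] assms by simp
    then obtain m where m: "1 \<le> m" "m \<le> n" "\<pi> m = 1" by auto
    then have "m = 1 \<or> m = n"
      using interior_minimum_not_parallel[OF \<pi>(1), of m] \<pi>(2) by fastforce
    then show ?thesis using m(3) by blast
  qed
  then have split: "parallel_permutations n = ?Q 1 \<union> ?Q n"
    by (auto simp: parallel_permutations_def)
  \<comment> \<open>As \<open>2 \<le> n\<close>, the positions \<open>1\<close> and \<open>n\<close>
    differ, so the value \<open>1\<close> cannot occupy both.\<close>
  have "?Q 1 \<inter> ?Q n = {}"
  proof -
    have "\<pi> 1 \<noteq> \<pi> n" if "\<pi> permutes {1..n}" for \<pi>
      by (rule permutes_Icc_neq[OF that]) (use assms in simp)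
    then show ?thesis by (metis (mono_tags, lifting) IntE equals0I mem_Collect_eq)
  qed
  moreover have "finite (?Q k)" for k
    by (rule finite_subset[OF _ finite_permutations[of "{1..n}"]]) auto
  moreover have "bij_betw (mirror_perm n) (?Q 1) (?Q n)"
  proof (rule bij_betwI[where g = "mirror_perm n"])
    have "mirror_perm n \<pi> n = \<pi> 1" "mirror_perm n \<pi> 1 = \<pi> n" for \<pi>
      using assms by (auto simp: mirror_perm_def)
    then show "mirror_perm n \<in> ?Q 1 \<rightarrow> ?Q n" "mirror_perm n \<in> ?Q n \<rightarrow> ?Q 1"
      using mirror_perm_permutes card_faces_mirror_perm by simp_all
  qed (simp_all add: mirror_perm_mirror_perm)
  ultimately have "card (parallel_permutations n) = 2 * card (?Q 1)"
    unfolding split by (simp add: card_Un_disjoint bij_betw_same_card)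
  then show ?thesis using card_parallel_from_1[OF assms] by simp
qed

end
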